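(* Assume the following three conditions hold. (a) For all $0\le k<i<j\le N$, $$\frac{c(z_j)-c(z_i)}{F(y_j)-F(y_i)}>\frac{c(z_i)-c(z_k)}{F(y_i)-F(y_k)}.$$ (b) For all $1\le i\le N-1$, $$\frac{C_i-C_{i-1}}{S_i-S_{i-1}}>\frac{\frac32\|f\|_\infty+\frac{\|f_{x_1}\|_\infty}{2}\left(1+S_i+C_i\right)}{\alpha}.$$ (c) For all $1\le i\le N-1$, $$S_i<\frac{2\alpha}{\|f\|_\infty\left(2+\frac{S_i}{S_{i-1}}\right)+\|f_{x_2}\|_\infty\left(1+\frac{2}{S_{i-1}}+\frac{C_i}{S_i}\right)}\left(1+\frac{\frac{C_i}{S_i}-\frac{C_{i-1}}{S_{i-1}}}{\frac1{S_{i-1}}-\frac1{S_i}}\right).$$ Then any solution $u\in\mathcal U$ of the monopolist's problem with data $(\mu,Y_N,c)$ is discretely nested.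
   Context: Setting: $X=(0,1)^2$, $\tilde y>0$, $F:[0,\tilde y]\to\mathbb R$ is increasing and convex with $F(0)=0$, and $z(y)=(y,F(y))$. $Y_N=\{y_0,\dots,y_N\}$ with $0=y_0<y_1<\dots<y_N\le\tilde y$, and $z_i=z(y_i)$. The preference function is $b(x,y)=x\cdot z(y)$. The cost $c$ is defined on the points $z(y)$, the map $y\mapsto c(z(y))$ is increasing and convex, and $c(0)=0$. $\mu$ is a probability measure on $X$ with density $f$ satisfying $0<\alpha\le f\le\|f\|_\infty<\infty$ for a fixed constant $\alpha$, with bounded gradient $Df=(f_{x_1},f_{x_2})\in L^\infty$. Notation: for $0\le i\le N-1$, $$S_i=\frac{F(y_{i+1})-F(y_i)}{y_{i+1}-y_i},\qquad C_i=\frac{c(z_{i+1})-c(z_i)}{y_{i+1}-y_i}.$$ Monopolist's problem with data $(\mu,Y_N,c)$: $\mathcal U$ is the set of functions $u:X\to\mathbb R$ of the form $u(x)=\max_{y\in Y_N}\,(b(x,y)-v(y))$ for some function $v$ on $Y_N$. Such $u$ is convex, and for a.e. $x$ one has $Du(x)\in\{z_0,\dots,z_N\}$; let $y^*(x)\in Y_N$ be determined a.e. by $Du(x)=z(y^*(x))$. The profit is $$\mathcal P(u)=\int_X\big(b(x,y^*(x))-u(x)-c(z(y^*(x)))\big)f(x)\,dx.$$ A solution is a maximizer of $\mathcal P(u)$ among all $u\in\mathcal U$ with $u\ge b(\cdot,y_0)=0$ on $X$ ($y_0=0$ is the opt-out good, of zero cost and zero price). Discrete nestedness: for $0\le i\le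 N-1$ and $k\in\mathbb R$ let $X^N_{\le}(y_i,k)=\{x\in X: b(x,y_{i+1})-b(x,y_i)\le k\}$ and $X^N_{<}(y_i,k)=\{x\in X: b(x,y_{i+1})-b(x,y_i)<k\}$. For $u\in\mathcal U$ put $v_r=\max_{x\in X}\{b(x,y_r)-u(x)\}$ (the maximum being a supremum over $X$, i.e. taken over $\overline X$ after continuous extension of $u$). Then $u$ is discretely nested if $X^N_{\le}(y_i,v_{i+1}-v_i)\subseteq X^N_{<}(y_j,v_{j+1}-v_j)$ for all $i<j$ in $\{0,\dots,N-1\}$. *)

theory Defs
  imports "HOL-Probability.Essential_Supremum" "HOL-Probability.Probability_Measure"
begin

definition X :: "(real \<times> real) set" where
  "X = {0<..<1} \<times> {0<..<1}"

definition z :: "(real \<Rightarrow> real) \<Rightarrow> real \<Rightarrow> real \<times> real" where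
  "z F t = (t, F t)"

definition b :: "(real \<Rightarrow> real) \<Rightarrow> real \<times> real \<Rightarrow> real \<Rightarrow> real" where
  "b F x t = x \<bullet> z F t"

text \<open>Norm and membership of \<open>L\<^sup>\<infinity>(X)\<close> with respect to Lebesgue measure. The library's
  \<^const>\<open>esssup\<close> needs values in a complete linear order, hence the passage through \<^typ>\<open>ereal\<close>.\<close>

definition Linf_norm :: "(real \<times> real \<Rightarrow> real) \<Rightarrow> real" where
  "Linf_norm g = real_of_ereal (esssup (lebesgue_on X) (\<lambda>x. ereal \<bar>g x\<bar>))"

definition in_Linf :: "(real \<times> real \<Rightarrow> real) \<Rightarrow> bool" where
  "in_Linf g \<longleftrightarrow> g \<in> borel_measurable (lebesgue_on X) \<and>
     esssup (lebesgue_on X) (\<lambda>x. ereal \<bar>g x\<bar>) < \<infinity>"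

text \<open>\<open>f\<close> has gradient \<open>(f1, f2)\<close> in \<open>L\<^sup>\<infinity>(X)\<close>. Since \<open>X\<close> is convex, this means that \<open>f\<close> is Lipschitz
  (for \<open>f\<close> in the Sobolev space \<open>W\<^sup>1\<^sup>,\<^sup>\<infinity>(X)\<close>: its continuous representative is) and the partial
  derivatives exist almost everywhere. Without the Lipschitz clause, functions with a singular
  (Cantor-type) part would be admitted, whose almost everywhere derivative is not their gradient.\<close>

definition has_bounded_gradient ::
  "(real \<times> real \<Rightarrow> real) \<Rightarrow> (real \<times> real \<Rightarrow> real) \<Rightarrow> (real \<times> real \<Rightarrow> real) \<Rightarrow> bool" where
  "has_bounded_gradient f f1 f2 \<longleftrightarrow>
     (\<exists>L. L-lipschitz_on X f) \<and>
     (AE x in lebesgue_on X.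
        ((\<lambda>s. f (s, snd x)) has_real_derivative f1 x) (at (fst x)) \<and>
        ((\<lambda>s. f (fst x, s)) has_real_derivative f2 x) (at (snd x))) \<and>
     in_Linf f1 \<and> in_Linf f2"

definition S :: "(real \<Rightarrow> real) \<Rightarrow> (nat \<Rightarrow> real) \<Rightarrow> nat \<Rightarrow> real" where
  "S F y i = (F (y (Suc i)) - F (y i)) / (y (Suc i) - y i)"

definition C :: "(real \<Rightarrow> real) \<Rightarrow> (real \<times> real \<Rightarrow> real) \<Rightarrow> (nat \<Rightarrow> real) \<Rightarrow> nat \<Rightarrow> real" where
  "C F c y i = (c (z F (y (Suc i))) - c (z F (y i))) / (y (Suc i) - y i)"

definition goods :: "(nat \<Rightarrow> real) \<Rightarrow> nat \<Rightarrow> real set" where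
  "goods y N = y ` {..N}"

text \<open>Only the values on \<^const>\<open>X\<close> of a utility function matter.\<close>

definition utilities ::
  "(real \<Rightarrow> real) \<Rightarrow> (nat \<Rightarrow> real) \<Rightarrow> nat \<Rightarrow> (real \<times> real \<Rightarrow> real) set" where
  "utilities F y N =
     {u. \<exists>v::real \<Rightarrow> real. \<forall>x\<in>X. u x = Max ((\<lambda>t. b F x t - v t) ` goods y N)}"

text \<open>The map \<open>z\<close> is injective, so the choice is unique wherever \<open>u\<close> is differentiable; the remaining
  null set, where \<open>THE\<close> is unspecified, does not affect the profit.\<close>

definition chosen_good ::
  "(real \<Rightarrow> real) \<Rightarrow> (nat \<Rightarrow> real) \<Rightarrow> nat \<Rightarrow> (real \<times> real \<Rightarrow> real) \<Rightarrow> real \<times> real \<Rightarrow> real" where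
  "chosen_good F y N u x = (THE t. t \<in> goods y N \<and> GDERIV u x :> z F t)"

definition profit ::
  "(real \<Rightarrow> real) \<Rightarrow> (real \<times> real \<Rightarrow> real) \<Rightarrow> (real \<times> real \<Rightarrow> real) \<Rightarrow> (nat \<Rightarrow> real) \<Rightarrow> nat \<Rightarrow>
   (real \<times> real \<Rightarrow> real) \<Rightarrow> real" where
  "profit F c f y N u =
     (LINT x | lebesgue_on X.
        (b F x (chosen_good F y N u x) - u x - c (z F (chosen_good F y N u x))) * f x)"

definition feasible ::
  "(real \<Rightarrow> real) \<Rightarrow> (nat \<Rightarrow> real) \<Rightarrow> nat \<Rightarrow> (real \<times> real \<Rightarrow> real) \<Rightarrow> bool" where
  "feasible F y N u \<longleftrightarrow> u \<in> utilities F y N \<and> (\<forall>x\<in>X. b F x (y 0) \<le> u x)"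

definition monopolist_solution ::
  "(real \<Rightarrow> real) \<Rightarrow> (real \<times> real \<Rightarrow> real) \<Rightarrow> (real \<times> real \<Rightarrow> real) \<Rightarrow> (nat \<Rightarrow> real) \<Rightarrow> nat \<Rightarrow>
   (real \<times> real \<Rightarrow> real) \<Rightarrow> bool" where
  "monopolist_solution F c f y N u \<longleftrightarrow>
     feasible F y N u \<and> (\<forall>w. feasible F y N w \<longrightarrow> profit F c f y N w \<le> profit F c f y N u)"

definition X_le :: "(real \<Rightarrow> real) \<Rightarrow> (nat \<Rightarrow> real) \<Rightarrow> nat \<Rightarrow> real \<Rightarrow> (real \<times> real) set" where
  "X_le F y i k = {x \<in> X. b F x (y (Suc i)) - b F x (y i) \<le> k}"

definition X_less :: "(real \<Rightarrow> real) \<Rightarrow> (nat \<Rightarrow> real) \<Rightarrow> nat \<Rightarrow> real \<Rightarrow> (real \<times> real) set" where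
  "X_less F y i k = {x \<in> X. b F x (y (Suc i)) - b F x (y i) < k}"

definition price ::
  "(real \<Rightarrow> real) \<Rightarrow> (nat \<Rightarrow> real) \<Rightarrow> (real \<times> real \<Rightarrow> real) \<Rightarrow> nat \<Rightarrow> real" where
  "price F y u r = (SUP x\<in>X. b F x (y r) - u x)"

definition discretely_nested ::
  "(real \<Rightarrow> real) \<Rightarrow> (nat \<Rightarrow> real) \<Rightarrow> nat \<Rightarrow> (real \<times> real \<Rightarrow> real) \<Rightarrow> bool" where
  "discretely_nested F y N u \<longleftrightarrow>
     (\<forall>i j. i < j \<and> j < N \<longrightarrow>
        X_le F y i (price F y u (Suc i) - price F y u i)
        \<subseteq> X_less F y j (price F y u (Suc j) - price F y u j))"

end

theory Submission
  imports Defs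
begin

text \<open>Call the line on which buyers are indifferent between the consecutive goods \<open>i\<close> and \<open>Suc i\<close>
  the threshold of \<open>i\<close>: in the row \<open>x\<^sub>2 = t\<close> it sits at \<open>x\<^sub>1 = level i - S i * t\<close>, and the buyers to its
  right prefer \<open>Suc i\<close>. The slopes \<open>S i\<close> strictly increase with \<open>i\<close>, so going up the threshold of a
  higher good moves left faster. Discrete nestedness says that inside the square the thresholds
  stay in their natural order; its failure means that two consecutive thresholds have met and
  exchanged their order (\<open>crossing\<close>).

  Suppose that this happens for a solution. Prices are tight, hence every good is a best choice for
  some buyer of the closed square, and this forces the meeting point of two crossing thresholds to
  lie in \<open>(0,1] \<times> [0,1)\<close>. Choose such a point \<open>(a, \<tau>)\<close> with the smallest \<open>\<tau>\<close>. By minimality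
  the thresholds passing through it are those of a block \<open>p, ..., r\<close> of consecutive goods, all
  smaller thresholds pass strictly to its left and all larger ones strictly to its right
  (\<open>lowest_crossing\<close>). The goods \<open>p + 1, ..., r\<close> are sold only below row \<open>\<tau>\<close>, in strips which all
  end at this vertex, and just above it goods \<open>p\<close> and \<open>Suc r\<close> are neighbours.

  Now make the inner goods \<open>p + 1, ..., r\<close> slightly cheaper, in such a way that the thresholds of the
  block still have a common vertex, moved up by \<open>e\<close> along the line that separates goods \<open>p\<close> and
  \<open>Suc r\<close>. If \<open>S0\<close> is the slope of the chord from good \<open>p\<close> to good \<open>Suc r\<close>, the level of \<open>q\<close> changes by
  \<open>e * (S q - S0)\<close>, and no other threshold is affected (\<open>profit_change_pointwise\<close>). The derivative of
  the profit is \<open>(\<Sum>q=p..r. (y (Suc q) - y q) * (S q - S0) * H q)\<close>, where \<open>H q\<close> is the mass to the right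
  of the threshold of \<open>q\<close> minus the markup \<open>level q - C q\<close> times the density of buyers on the part of
  that threshold below the vertex. The weights \<open>(y (Suc q) - y q) * (S q - S0)\<close> sum to zero and
  \<open>S q - S0\<close> increases, so the derivative is positive by Chebyshev's sum inequality provided that \<open>H\<close>
  increases strictly. Going from \<open>q - 1\<close> to \<open>q\<close> one loses the mass of the strip between two
  thresholds and gains from the growth of the unit cost \<open>C\<close>. The condition on \<open>C\<close> against \<open>S\<close> makes the
  gain larger when the two thresholds are compared row by row (\<open>bottom_estimate\<close>). This comparison
  breaks down if the upper threshold of the strip leaves the square through the right side and has a
  negative markup; then the thresholds are compared column by column, using the condition on \<open>C / S\<close>
  (\<open>side_estimate\<close>).

  Hence the profit strictly increases with \<open>e\<close>, which contradicts optimality. The derivative is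
  needed only for \<open>e > 0\<close>. This matters because at \<open>e = 0\<close> the goods of the block may be unsold, with
  the vertex on the boundary of the square, and then the derivative vanishes there.\<close>

section \<open>Lipschitz bounds from the gradient\<close>

text \<open>Each value between \<open>g p\<close> and \<open>g q\<close> is attained a last time, and there \<open>g\<close> cannot have a negative
  derivative. If \<open>g p < g q\<close>, an open interval of values would thus be contained in the image of the
  null set \<open>N\<close>, which is null since \<open>g\<close> is Lipschitz.\<close>

lemma antimono_of_AE_deriv_neg:
  fixes g :: "real \<Rightarrow> real"
  assumes lip: "K-lipschitz_on {p..q} g" and "p \<le> q" and N: "negligible N"
    and deriv: "\<And>x. x \<in> {p<..<q} - N \<Longrightarrow> \<exists>D<0. (g has_real_derivative D) (at x)"
  shows "g q \<le> g p"
proof (rule ccontr)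
  assume "\<not> g q \<le> g p"
  then have less: "g p < g q" by simp
  have cont: "continuous_on {p..q} g" using lip by (rule lipschitz_on_continuous_on)
  have "{g p<..<g q} \<subseteq> g ` (N \<inter> {p..q})"
  proof
    fix w assume w: "w \<in> {g p<..<g q}"
    \<comment> \<open>the maximum of \<open>T\<close> is the last point at which the value \<open>w\<close> is attained\<close>
    define T where "T = {x \<in> {p..q}. g x \<le> w}"
    have T: "compact T"
    proof -
      have "closed T" unfolding T_def
        by (rule continuous_on_closed_Collect_le) (auto intro: continuous_intros cont)
      moreover have "bounded T" unfolding T_def by (rule bounded_subset[of "{p..q}"]) auto
      ultimately show ?thesis by (simp add: compact_eq_bounded_closed)
    qed
    have "p \<in> T" using w \<open>p \<le> q\<close> by (auto simp: T_def)
    then obtain s where s: "s \<in> T" "\<And>x. x \<in> T \<Longrightarrow> x \<le> s"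
      using compact_attains_sup[OF T] by blast
    have sq: "p \<le> s" "s \<le> q" "g s \<le> w" using s(1) by (auto simp: T_def)
    obtain x where x: "s \<le> x" "x \<le> q" "g x = w"
      using IVT'[of g s w q] sq w continuous_on_subset[OF cont, of "{s..q}"] by auto
    then have "x = s" using s sq by (fastforce simp: T_def)
    then have gs: "g s = w" using x by simp
    have "p < s" "s < q" using gs w sq by (auto simp: less_le)
    have "s \<in> N"
    proof (rule ccontr)
      assume "s \<notin> N"
      then obtain D where "D < 0" "(g has_real_derivative D) (at s)"
        using deriv[of s] \<open>p < s\<close> \<open>s < q\<close> by auto
      then obtain d where d: "d > 0" "\<And>h. 0 < h \<Longrightarrow> h < d \<Longrightarrow> g (s + h) < g s"
        using DERIV_neg_dec_right by blast
      define h where "h = min (d / 2) (q - s)"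
      have "0 < h" "h < d" "s + h \<le> q" using d \<open>s < q\<close> by (auto simp: h_def)
      then have "s + h \<in> T" using d(2)[of h] gs \<open>p < s\<close> by (auto simp: T_def)
      then show False using s(2)[of "s + h"] \<open>0 < h\<close> by simp
    qed
    then show "w \<in> g ` (N \<inter> {p..q})" using gs sq by auto
  qed
  moreover have "negligible (g ` (N \<inter> {p..q}))"
  proof (rule negligible_locally_Lipschitz_image)
    show "negligible (N \<inter> {p..q})" by (rule negligible_subset[OF N]) auto
    show "\<exists>T B. open T \<and> x \<in> T \<and> (\<forall>y\<in>(N \<inter> {p..q}) \<inter> T. norm (g y - g x) \<le> B * norm (y - x))"
      if "x \<in> N \<inter> {p..q}" for x
      using lipschitz_onD[OF lip] that by (intro exI[of _ UNIV] exI[of _ K]) (auto simp: dist_real_def)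
  qed simp
  ultimately have "negligible {g p<..<g q}" using negligible_subset by blast
  then show False using less open_not_negligible[of "{g p<..<g q}"] by auto
qed

lemma AE_lborel_obtain_negligible:
  assumes "AE x in lborel. P x"
  obtains A where "negligible A" "\<And>x. x \<notin> A \<Longrightarrow> P x"
proof -
  obtain A where "\<And>x. x \<in> space lborel - A \<Longrightarrow> P x" "A \<in> null_sets lborel"
    using assms by (rule AE_E3) blast
  then show thesis
    by (intro that[of A]) (simp_all add: negligible_iff_null_sets null_sets_completionI)
qed

text \<open>Subtracting from \<open>g\<close> or \<open>- g\<close> a linear function of slope slightly above \<open>L\<close> makes the derivative
  negative almost everywhere.\<close>

lemma lipschitz_bound_of_AE_deriv_bound:
  fixes g :: "real \<Rightarrow> real"
  assumes lip: "K-lipschitz_on I g" and "{p..q} \<subseteq> I" and "p \<le> q"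
    and AE: "AE x in lborel. x \<in> {p<..<q} \<longrightarrow> (\<exists>D. (g has_real_derivative D) (at x) \<and> \<bar>D\<bar> \<le> L)"
  shows "\<bar>g q - g p\<bar> \<le> L * (q - p)"
proof -
  obtain N0 where N: "negligible N0"
    and N0: "\<And>x. x \<notin> N0 \<Longrightarrow> x \<in> {p<..<q} \<longrightarrow> (\<exists>D. (g has_real_derivative D) (at x) \<and> \<bar>D\<bar> \<le> L)"
    using AE by (rule AE_lborel_obtain_negligible) blast
  have lip': "K-lipschitz_on {p..q} g" using lip \<open>{p..q} \<subseteq> I\<close> by (rule lipschitz_on_subset)
  have one: "s * (g q - g p) \<le> (L + d) * (q - p)" if "d > 0" "\<bar>s\<bar> = 1" for s d
  proof -
    let ?\<phi> = "\<lambda>x. s * g x - (L + d) * x"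
    have "\<exists>B. B-lipschitz_on {p..q} ?\<phi>"
      using lipschitz_on_diff[OF lipschitz_on_cmult_real[OF lip', of s]
          lipschitz_on_cmult_real[OF lipschitz_on_id, of "L + d"]] by auto
    then obtain B where B: "B-lipschitz_on {p..q} ?\<phi>" by blast
    have "?\<phi> q \<le> ?\<phi> p"
    proof (rule antimono_of_AE_deriv_neg[OF B \<open>p \<le> q\<close> N])
      fix x assume "x \<in> {p<..<q} - N0"
      then obtain D where D: "(g has_real_derivative D) (at x)" "\<bar>D\<bar> \<le> L" using N0 by blast
      have "(?\<phi> has_real_derivative s * D - (L + d)) (at x)"
        by (auto intro!: derivative_eq_intros D(1))
      moreover have "s * D - (L + d) < 0"
        using D(2) that by (cases "s \<ge> 0") (auto simp: abs_if split: if_splits)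
      ultimately show "\<exists>D<0. (?\<phi> has_real_derivative D) (at x)" by blast
    qed
    then show ?thesis by (simp add: algebra_simps)
  qed
  have lim: "s * (g q - g p) \<le> L * (q - p)" if "\<bar>s\<bar> = 1" for s
  proof (rule tendsto_lowerbound)
    show "((\<lambda>d. (L + d) * (q - p)) \<longlongrightarrow> L * (q - p)) (at_right 0)"
      by (rule tendsto_eq_intros | simp)+
    show "\<forall>\<^sub>F d in at_right 0. s * (g q - g p) \<le> (L + d) * (q - p)"
      using one that by (auto simp: eventually_at_right_less intro: eventually_at_rightI[of 0 1])
  qed simp
  from lim[of 1] lim[of "-1"] show ?thesis by auto
qed

lemma open_X: "open X" unfolding X_def by (intro open_Times) auto

lemma X_borel [measurable]: "X \<in> sets borel" using open_X by auto

lemma mem_X [simp]: "(s, t) \<in> X \<longleftrightarrow> 0 < s \<and> s < 1 \<and> 0 < t \<and> t < 1"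
  by (auto simp: X_def)

lemma AE_lebesgue_on_X:
  "(AE x in lebesgue_on X. P x) \<longleftrightarrow> (AE x in lborel. x \<in> X \<longrightarrow> P x)"
  by (simp add: AE_restrict_space_iff AE_completion_iff sets_completionI)

lemma pointwise_of_AE:
  fixes g :: "'a::euclidean_space \<Rightarrow> real"
  assumes AE: "AE x in lborel. x \<in> U \<longrightarrow> g x \<le> B" and g: "continuous_on U g"
    and "open U" and "x \<in> U"
  shows "g x \<le> B"
proof (rule ccontr)
  assume "\<not> g x \<le> B"
  then have "x \<in> U \<inter> g -` {B<..}" using \<open>x \<in> U\<close> by simp
  moreover have "open (U \<inter> g -` {B<..})" 
    using g \<open>open U\<close> by (rule continuous_open_preimage) simp
  ultimately have "\<not> negligible (U \<inter> g -` {B<..})" using open_not_negligible by blast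
  moreover have "negligible (U \<inter> g -` {B<..})"
  proof -
    obtain A where "negligible A" and A: "\<And>w. w \<notin> A \<Longrightarrow> w \<in> U \<longrightarrow> g w \<le> B"
      using AE by (rule AE_lborel_obtain_negligible) blast
    from \<open>negligible A\<close> show ?thesis by (rule negligible_subset) (use A in force)
  qed
  ultimately show False by blast
qed

lemma nontrivial_lebesgue_on_X: "emeasure (lebesgue_on X) (space (lebesgue_on X)) \<noteq> 0"
proof -
  have "(1/2, 1/2) \<in> X" by simp
  then have "X \<noteq> {}" by blast
  then have "\<not> negligible X" using open_not_negligible open_X by blast
  then show ?thesis
    by (auto simp: negligible_iff_null_sets null_sets_def emeasure_restrict_space)
qed

text \<open>The conversion from extended reals loses nothing, because the essential supremum is finite by
  assumption and nonnegative as \<open>X\<close> has positive measure.\<close>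

lemma in_Linf_AE_bound:
  assumes "in_Linf g"
  shows "AE x in lborel. x \<in> X \<longrightarrow> \<bar>g x\<bar> \<le> Linf_norm g" and "0 \<le> Linf_norm g"
proof -
  let ?e = "esssup (lebesgue_on X) (\<lambda>x. ereal \<bar>g x\<bar>)"
  have le: "AE x in lebesgue_on X. ereal \<bar>g x\<bar> \<le> ?e" by (rule esssup_AE)
  have "AE x in lebesgue_on X. 0 \<le> ?e"
    using le by eventually_elim (meson abs_ge_zero ereal_less_eq(5) order_trans)
  then have nn: "0 \<le> ?e"
    using nontrivial_lebesgue_on_X by (simp only: eventually_const ae_filter_eq_bot_iff simp_thms)
  then have e: "?e = ereal (Linf_norm g)"
    using assms unfolding in_Linf_def Linf_norm_def by (cases ?e) auto
  show "0 \<le> Linf_norm g" using nn e by simp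
  show "AE x in lborel. x \<in> X \<longrightarrow> \<bar>g x\<bar> \<le> Linf_norm g"
    using le unfolding e AE_lebesgue_on_X by simp
qed

text \<open>A null set of the plane meets almost every vertical and almost every horizontal line in a null
  set.\<close>

lemma AE_rows:
  fixes P :: "real \<times> real \<Rightarrow> bool"
  assumes "AE x in lborel. P x"
  shows "AE s in lborel. AE t in lborel. P (s, t)" and "AE t in lborel. AE s in lborel. P (s, t)"
proof -
  have AE: "AE x in lborel \<Otimes>\<^sub>M lborel. P x" using assms unfolding lborel_prod .
  then show "AE s in lborel. AE t in lborel. P (s, t)" by (rule lborel_pair.AE_pair)
  have "AE x in lborel \<Otimes>\<^sub>M lborel. P (snd x, fst x)"
  proof -
    have "AE x in distr (lborel \<Otimes>\<^sub>M lborel) (lborel \<Otimes>\<^sub>M lborel) (\<lambda>(x, y). (y, x)). P x"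
      using AE lborel_pair.distr_pair_swap by metis
    from AE_distrD[OF _ this] show ?thesis by (simp add: split_beta)
  qed
  then have "AE x in lborel. AE y in lborel. P (snd (x, y), fst (x, y))" by (rule lborel_pair.AE_pair)
  then show "AE t in lborel. AE s in lborel. P (s, t)" by simp
qed

lemma le_Linf_norm:
  assumes "in_Linf f" and "continuous_on X f" and "x \<in> X"
  shows "f x \<le> Linf_norm f"
proof (rule pointwise_of_AE[OF _ assms(2) open_X assms(3)])
  show "AE x in lborel. x \<in> X \<longrightarrow> f x \<le> Linf_norm f"
    using in_Linf_AE_bound(1)[OF assms(1)] by eventually_elim auto
qed

text \<open>Almost every section has the required derivative bound almost everywhere, and the Lipschitz
  estimate passes from these sections to all others by continuity in \<open>t\<close>.\<close>

lemma section_lipschitz: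
  fixes g :: "real \<Rightarrow> real \<Rightarrow> real"
  assumes lip: "\<And>t. t \<in> {0<..<1} \<Longrightarrow> K-lipschitz_on {0<..<1} (\<lambda>s. g s t)"
    and cont: "\<And>s. s \<in> {0<..<1} \<Longrightarrow> continuous_on {0<..<1} (g s)"
    and AE: "AE t in lborel. AE s in lborel. s \<in> {0<..<1} \<longrightarrow> t \<in> {0<..<1} \<longrightarrow>
        (\<exists>D. ((\<lambda>s. g s t) has_real_derivative D) (at s) \<and> \<bar>D\<bar> \<le> L)"
    and mem: "s \<in> {0<..<1}" "s' \<in> {0<..<1}" "t \<in> {0<..<1}"
  shows "\<bar>g s t - g s' t\<bar> \<le> L * \<bar>s - s'\<bar>"
proof -
  have wlog: "\<bar>g q t - g p t\<bar> \<le> L * (q - p)"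
    if "p \<le> q" "p \<in> {0<..<1}" "q \<in> {0<..<1}" for p q
  proof (rule pointwise_of_AE[where U = "{0<..<1}" and g = "\<lambda>t. \<bar>g q t - g p t\<bar>" and x = t])
    show "AE t in lborel. t \<in> {0<..<1} \<longrightarrow> \<bar>g q t - g p t\<bar> \<le> L * (q - p)"
      using AE
    proof eventually_elim
      fix t assume *: "AE s in lborel. s \<in> {0<..<1} \<longrightarrow> t \<in> {0<..<1} \<longrightarrow>
        (\<exists>D. ((\<lambda>s. g s t) has_real_derivative D) (at s) \<and> \<bar>D\<bar> \<le> L)"
      show "t \<in> {0<..<1} \<longrightarrow> \<bar>g q t - g p t\<bar> \<le> L * (q - p)"
      proof
        assume t: "t \<in> {0<..<1}"
        show "\<bar>g q t - g p t\<bar> \<le> L * (q - p)"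
        proof (rule lipschitz_bound_of_AE_deriv_bound[OF lip[OF t] _ \<open>p \<le> q\<close>])
          show "{p..q} \<subseteq> {0<..<1}" using that by auto
          show "AE s in lborel. s \<in> {p<..<q} \<longrightarrow>
              (\<exists>D. ((\<lambda>s. g s t) has_real_derivative D) (at s) \<and> \<bar>D\<bar> \<le> L)"
            using * by eventually_elim (use t that in auto)
        qed
      qed
    qed
    show "continuous_on {0<..<1} (\<lambda>t. \<bar>g q t - g p t\<bar>)"
      using that by (intro continuous_intros cont)
  qed (use mem in auto)
  show ?thesis
    using wlog[of s s'] wlog[of s' s] mem by (cases "s \<le> s'") (auto simp: abs_minus_commute)
qed

lemma has_bounded_gradient_lipschitz:
  assumes grad: "has_bounded_gradient f f1 f2" and X: "(s, t) \<in> X" "(s', t) \<in> X" "(s, t') \<in> X"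
  shows "\<bar>f (s, t) - f (s', t)\<bar> \<le> Linf_norm f1 * \<bar>s - s'\<bar>"
    and "\<bar>f (s, t) - f (s, t')\<bar> \<le> Linf_norm f2 * \<bar>t - t'\<bar>"
proof -
  obtain K where lip: "K-lipschitz_on X f" and L: "in_Linf f1" "in_Linf f2"
    and AE: "AE x in lborel. x \<in> X \<longrightarrow>
        ((\<lambda>s. f (s, snd x)) has_real_derivative f1 x) (at (fst x)) \<and>
        ((\<lambda>s. f (fst x, s)) has_real_derivative f2 x) (at (snd x))"
    using grad unfolding has_bounded_gradient_def AE_lebesgue_on_X by auto
  have K: "0 \<le> K" using lip by (rule lipschitz_on_nonneg)
  have lip1: "K-lipschitz_on {0<..<1} (\<lambda>s. f (s, t))" if "t \<in> {0<..<1}" for t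
    using lipschitz_onD[OF lip, of "(_, t)" "(_, t)"] K that
    by (intro lipschitz_onI) (auto simp: dist_Pair_Pair)
  have lip2: "K-lipschitz_on {0<..<1} (\<lambda>t. f (s, t))" if "s \<in> {0<..<1}" for s
    using lipschitz_onD[OF lip, of "(s, _)" "(s, _)"] K that
    by (intro lipschitz_onI) (auto simp: dist_Pair_Pair)
  have "AE x in lborel. x \<in> X \<longrightarrow>
      (\<exists>D. ((\<lambda>s. f (s, snd x)) has_real_derivative D) (at (fst x)) \<and> \<bar>D\<bar> \<le> Linf_norm f1)"
    using AE in_Linf_AE_bound(1)[OF L(1)] by eventually_elim auto
  from AE_rows(2)[OF this]
  show "\<bar>f (s, t) - f (s', t)\<bar> \<le> Linf_norm f1 * \<bar>s - s'\<bar>"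
    using X lip1 lip2[THEN lipschitz_on_continuous_on]
    by (intro section_lipschitz[where g = "\<lambda>s t. f (s, t)"]) (auto elim!: eventually_mono)
  have "AE x in lborel. x \<in> X \<longrightarrow>
      (\<exists>D. ((\<lambda>s. f (fst x, s)) has_real_derivative D) (at (snd x)) \<and> \<bar>D\<bar> \<le> Linf_norm f2)"
    using AE in_Linf_AE_bound(1)[OF L(2)] by eventually_elim auto
  from AE_rows(1)[OF this]
  show "\<bar>f (s, t) - f (s, t')\<bar> \<le> Linf_norm f2 * \<bar>t - t'\<bar>"
    using X lip2 lip1[THEN lipschitz_on_continuous_on]
    by (intro section_lipschitz[where g = "\<lambda>t s. f (s, t)"]) (auto elim!: eventually_mono)
qed

lemma integrable_bounded_support:
  fixes g :: "real \<Rightarrow> real"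
  assumes "g \<in> borel_measurable lborel" and "\<And>t. \<bar>g t\<bar> \<le> B * indicator {p..q} t"
  shows "integrable lborel g"
proof (rule Bochner_Integration.integrable_bound)
  show "integrable lborel (\<lambda>t. B * indicator {p..q} t)"
    by (intro integrable_mult_right integrable_real_indicator) (auto simp: emeasure_lborel_Icc_eq)
qed (use assms order_trans[OF assms(2) abs_ge_self] in auto)

section \<open>Masses cut off by a moving line\<close>

text \<open>Dominated convergence for the difference quotients: \<open>\<phi>\<close> may fail to be differentiable on a null
  set that depends on \<open>e\<close>.\<close>

lemma has_real_derivative_integral:
  fixes \<phi> :: "real \<Rightarrow> 'a \<Rightarrow> real"
  assumes int: "\<And>e. integrable M (\<phi> e)" and w: "integrable M w" and \<psi>: "\<psi> \<in> borel_measurable M"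
    and lip: "\<And>d e t. \<bar>\<phi> d t - \<phi> e t\<bar> \<le> w t * \<bar>d - e\<bar>"
    and deriv: "AE t in M. ((\<lambda>e. \<phi> e t) has_real_derivative \<psi> t) (at e)"
  shows "((\<lambda>e. \<integral>t. \<phi> e t \<partial>M) has_real_derivative (\<integral>t. \<psi> t \<partial>M)) (at e)"
  unfolding has_field_derivative_iff tendsto_at_iff_sequentially
proof (intro allI impI)
  fix Y :: "nat \<Rightarrow> real" assume Y: "\<forall>i. Y i \<in> UNIV - {e}" "Y \<longlonglongrightarrow> e"
  have [measurable]: "\<phi> d \<in> borel_measurable M" for d using int by (rule borel_measurable_integrable)
  have "(\<lambda>i. \<integral>t. (\<phi> (Y i) t - \<phi> e t) / (Y i - e) \<partial>M) \<longlonglongrightarrow> (\<integral>t. \<psi> t \<partial>M)"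
  proof (rule integral_dominated_convergence[OF \<psi> _ w])
    show "AE t in M. (\<lambda>i. (\<phi> (Y i) t - \<phi> e t) / (Y i - e)) \<longlonglongrightarrow> \<psi> t"
      using deriv
    proof eventually_elim
      case (elim t)
      then have "(\<lambda>d. (\<phi> d t - \<phi> e t) / (d - e)) \<midarrow>e\<rightarrow> \<psi> t" by (simp add: has_field_derivative_iff)
      then show ?case using Y unfolding tendsto_at_iff_sequentially by (auto simp: o_def)
    qed
    show "AE t in M. norm ((\<phi> (Y i) t - \<phi> e t) / (Y i - e)) \<le> w t" for i
      using lip[of "Y i" _ e] Y(1) by (auto simp: abs_divide divide_le_eq)
  qed measurable
  then show "((\<lambda>d. ((\<integral>t. \<phi> d t \<partial>M) - (\<integral>t. \<phi> e t \<partial>M)) / (d - e)) \<circ> Y) \<longlonglongrightarrow> (\<integral>t. \<psi> t \<partial>M)"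
    by (simp add: o_def int)
qed

text \<open>The threshold of a good in the block when the common vertex has been moved from \<open>(a, \<tau>)\<close> to
  \<open>(a - S0 * e, \<tau> + e)\<close>: a line of slope \<open>S0 + \<sigma>\<close> below the moved vertex, continued above it by the
  line of slope \<open>S0\<close> along which the vertex moves. Above the vertex the cuts of all goods of the
  block coincide and do not depend on \<open>e\<close>.\<close>

definition cut :: "real \<Rightarrow> real \<Rightarrow> real \<Rightarrow> real \<Rightarrow> real \<Rightarrow> real \<Rightarrow> real" where
  "cut a \<tau> S0 \<sigma> e t = a + S0 * (\<tau> - t) + \<sigma> * max (\<tau> + e - t) 0"

lemma cut_measurable [measurable]: "cut a \<tau> S0 \<sigma> e \<in> borel_measurable borel"
  unfolding cut_def[abs_def] by measurable

lemma cut_lipschitz: "\<bar>cut a \<tau> S0 \<sigma> d t - cut a \<tau> S0 \<sigma> e t\<bar> \<le> \<bar>\<sigma>\<bar> * \<bar>d - e\<bar>"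
proof -
  have "cut a \<tau> S0 \<sigma> d t - cut a \<tau> S0 \<sigma> e t = \<sigma> * (max (\<tau> + d - t) 0 - max (\<tau> + e - t) 0)"
    by (simp add: cut_def algebra_simps)
  moreover have "\<bar>max (\<tau> + d - t) 0 - max (\<tau> + e - t) 0\<bar> \<le> \<bar>d - e\<bar>" by auto
  ultimately show ?thesis by (simp add: abs_mult mult_left_mono)
qed

lemma cut_below:
  assumes "t \<le> \<tau> + e"
  shows "cut a \<tau> S0 \<sigma> e t = (a - S0 * e) + (S0 + \<sigma>) * (\<tau> + e - t)"
proof -
  have "max (\<tau> + e - t) 0 = \<tau> + e - t" using assms by simp
  then show ?thesis by (simp add: cut_def algebra_simps)
qed

lemma cut_above:
  assumes "\<tau> + e \<le> t"
  shows "cut a \<tau> S0 \<sigma> e t = a + S0 * (\<tau> - t)"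
  using assms by (simp add: cut_def max_def)

text \<open>The density of buyers enters the estimates only through these bounds; \<open>K\<close>, \<open>L1\<close> and \<open>L2\<close> stand for
  the supremum norms of \<open>f\<close> and of its partial derivatives.\<close>

locale bounded_density =
  fixes f :: "real \<times> real \<Rightarrow> real" and \<alpha> K L1 L2 :: real
  assumes cont: "continuous_on X f" and \<alpha>_pos: "0 < \<alpha>"
    and f_ge: "\<And>x. x \<in> X \<Longrightarrow> \<alpha> \<le> f x" and f_le: "\<And>x. x \<in> X \<Longrightarrow> f x \<le> K"
    and lip1: "\<And>s s' t. (s, t) \<in> X \<Longrightarrow> (s', t) \<in> X \<Longrightarrow> \<bar>f (s, t) - f (s', t)\<bar> \<le> L1 * \<bar>s - s'\<bar>"
    and lip2: "\<And>s t t'. (s, t) \<in> X \<Longrightarrow> (s, t') \<in> X \<Longrightarrow> \<bar>f (s, t) - f (s, t')\<bar> \<le> L2 * \<bar>t - t'\<bar>"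
    and L1_nonneg: "0 \<le> L1" and L2_nonneg: "0 \<le> L2"
begin

text \<open>Extended by zero, the density takes care of lines that leave the square.\<close>

definition dens :: "real \<times> real \<Rightarrow> real" where
  "dens x = indicator X x * f x"

definition tail :: "real \<Rightarrow> real \<Rightarrow> real" where
  "tail t x = (LBINT s. (if x < s then dens (s, t) else 0))"

lemma dens_in: "x \<in> X \<Longrightarrow> dens x = f x" and dens_out: "x \<notin> X \<Longrightarrow> dens x = 0"
  by (auto simp: dens_def)

lemma dens_measurable [measurable]: "dens \<in> borel_measurable borel"
  using borel_measurable_continuous_on_indicator[OF X_borel cont] by (simp add: dens_def[abs_def])

lemma dens_measurable_pair [measurable]: "dens \<in> borel_measurable (borel \<Otimes>\<^sub>M borel)"
  using dens_measurable by (simp add: borel_prod)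

lemma \<alpha>_le_K: "\<alpha> \<le> K"
  using f_ge[of "(1/2, 1/2)"] f_le[of "(1/2, 1/2)"] by simp

lemma K_pos: "0 < K" using \<alpha>_le_K \<alpha>_pos by simp

lemma dens_nonneg: "0 \<le> dens x" and dens_le: "dens x \<le> K"
  using f_ge[of x] f_le[of x] \<alpha>_pos K_pos by (cases "x \<in> X"; simp add: dens_in dens_out)+

lemma dens_section_le: "\<bar>dens (s, t)\<bar> \<le> K * indicator {0..1} s" "\<bar>dens (s, t)\<bar> \<le> K * indicator {0..1} t"
  using dens_nonneg[of "(s, t)"] dens_le[of "(s, t)"] dens_out[of "(s, t)"] 
  by (auto simp: indicator_def)

lemma integrable_tail: "integrable lborel (\<lambda>s. if x < s then dens (s, t) else 0)"
  by (rule integrable_bounded_support[where B = K and p = 0 and q = 1])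
    (use dens_section_le K_pos in \<open>auto simp: indicator_def\<close>)

lemma tail_diff:
  assumes "x \<le> y"
  shows "tail t x - tail t y = (LBINT s. (if x < s \<and> s \<le> y then dens (s, t) else 0))"
  unfolding tail_def using assms
  by (subst Bochner_Integration.integral_diff[OF integrable_tail integrable_tail, symmetric])
    (auto intro!: Bochner_Integration.integral_cong)

lemma tail_diff_bounds:
  assumes "x \<le> y"
  shows "0 \<le> tail t x - tail t y" "tail t x - tail t y \<le> K * (min y 1 - min x 1)"
proof -
  show "0 \<le> tail t x - tail t y"
    unfolding tail_diff[OF assms] by (rule integral_nonneg_AE) (auto simp: dens_nonneg)
  have "tail t x - tail t y \<le> (LBINT s. K * indicator {min x 1<..min y 1} s)"
    unfolding tail_diff[OF assms]
  proof (rule integral_mono)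
    show "integrable lborel (\<lambda>s. if x < s \<and> s \<le> y then dens (s, t) else 0)"
      by (rule integrable_bounded_support[where B = K and p = 0 and q = 1])
        (use dens_section_le K_pos in \<open>auto simp: indicator_def\<close>)
    show "integrable lborel (\<lambda>s. K * indicator {min x 1<..min y 1} s)"
      using assms by (intro integrable_mult_right integrable_real_indicator) (auto simp: min_def)
    show "(if x < s \<and> s \<le> y then dens (s, t) else 0) \<le> K * indicator {min x 1<..min y 1} s" for s
      using dens_le[of "(s, t)"] dens_out[of "(s, t)"] K_pos
      by (cases "s < 1") (auto simp: indicator_def)
  qed
  then show "tail t x - tail t y \<le> K * (min y 1 - min x 1)"
    using assms by (simp add: min_def split: if_splits)
qed

lemma tail_lipschitz: "\<bar>tail t x - tail t y\<bar> \<le> K * \<bar>x - y\<bar>"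
proof -
  have *: "\<bar>tail t x - tail t y\<bar> \<le> K * \<bar>x - y\<bar>" if "x \<le> y" for x y
  proof -
    have "K * (min y 1 - min x 1) \<le> K * \<bar>x - y\<bar>" using K_pos that by (intro mult_left_mono) auto
    then show ?thesis using tail_diff_bounds[OF that, of t] by linarith
  qed
  show ?thesis using *[of x y] *[of y x] by (cases "x \<le> y") (auto simp: abs_minus_commute)
qed

lemma tail_eq_0: "1 \<le> x \<Longrightarrow> tail t x = 0" "t \<notin> {0<..<1} \<Longrightarrow> tail t x = 0"
  unfolding tail_def by (rule integral_eq_zero_AE, auto intro!: AE_I2 dens_out)+

lemma tail_measurable [measurable]:
  assumes [measurable]: "h \<in> borel_measurable borel"
  shows "(\<lambda>t. tail t (h t)) \<in> borel_measurable borel"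
  unfolding tail_def by (rule lborel.borel_measurable_lebesgue_integral) measurable

lemma tail_bound: "\<bar>tail t x\<bar> \<le> K * indicator {0..1} t"
proof (cases "t \<in> {0<..<1}")
  case True
  have "integrable lborel (\<lambda>s. K * indicat_real {0..1::real} s)"
    by (intro integrable_mult_right integrable_real_indicator) auto
  then have "norm (tail t x) \<le> (LBINT s. K * indicat_real {0..1::real} s)"
    unfolding tail_def
    by (rule Bochner_Integration.integral_norm_bound_integral[OF integrable_tail])
      (use dens_section_le K_pos in \<open>auto simp: indicator_def\<close>)
  then show ?thesis using True by simp
qed (use K_pos in \<open>simp add: tail_eq_0\<close>)

lemma integrable_tail_section:
  assumes [measurable]: "h \<in> borel_measurable borel"
  shows "integrable lborel (\<lambda>t. tail t (h t))"
  by (rule integrable_bounded_support[where B = K and p = 0 and q = 1]) (auto simp: tail_bound)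

text \<open>The mass between \<open>x\<close> and a nearby \<open>y\<close> is \<open>f (x, t) * (y - x)\<close> up to a quadratic error, by the
  Lipschitz bound for \<open>f\<close> in its first argument.\<close>

lemma tail_has_derivative:
  assumes "t \<in> {0<..<1}" "0 < x" "x \<noteq> 1"
  shows "(tail t has_real_derivative - dens (x, t)) (at x)"
proof (cases "x < 1")
  case False
  have "\<forall>\<^sub>F y in nhds x. y > 1" using assms False by (intro order_tendstoD(1)[OF filterlim_ident]) auto
  then have "\<forall>\<^sub>F y in nhds x. tail t y = 0" by eventually_elim (simp add: tail_eq_0)
  then have "(tail t has_real_derivative 0) (at x)"
    by (subst DERIV_cong_ev[of x x _ "\<lambda>_. 0"]) auto
  then show ?thesis using False by (simp add: dens_out)
next
  case True
  have quad: "\<bar>tail t p - tail t q - d * (q - p)\<bar> \<le> L1 * (q - p)\<^sup>2"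
    if pq: "0 < p" "p \<le> q" "q < 1" and z: "p \<le> z" "z \<le> q" and d: "d = dens (z, t)" for p q z d
  proof -
    let ?I = "\<lambda>s. p < s \<and> s \<le> q"
    have int: "integrable lborel (\<lambda>s. if ?I s then dens (s, t) else 0)"
      by (rule integrable_bounded_support[where B = K and p = 0 and q = 1])
        (use dens_section_le K_pos in \<open>auto simp: indicator_def\<close>)
    have ind: "integrable lborel (indicat_real {p<..q})"
      using pq by (intro integrable_real_indicator) auto
    have "tail t p - tail t q - d * (q - p)
        = (LBINT s. (if ?I s then dens (s, t) else 0) - d * indicator {p<..q} s)"
      using pq int ind by (simp add: tail_diff)
    also have "\<bar>\<dots>\<bar> \<le> (LBINT s. L1 * (q - p) * indicator {p<..q} s)"
      unfolding real_norm_def[symmetric]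
    proof (rule Bochner_Integration.integral_norm_bound_integral)
      show "norm ((if ?I s then dens (s, t) else 0) - d * indicator {p<..q} s)
          \<le> L1 * (q - p) * indicator {p<..q} s" for s
      proof (cases "?I s")
        case True
        then have "\<bar>f (s, t) - f (z, t)\<bar> \<le> L1 * \<bar>s - z\<bar>"
          using pq z assms(1) by (intro lip1) auto
        also have "\<dots> \<le> L1 * (q - p)" using True z L1_nonneg by (intro mult_left_mono) auto
        finally show ?thesis using True pq z assms(1) d by (simp add: dens_in)
      qed auto
    qed (use int ind in auto)
    also have "\<dots> = L1 * (q - p)\<^sup>2" using pq by (simp add: power2_eq_square)
    finally show ?thesis .
  qed
  have bound: "norm ((tail t y - tail t x) / (y - x) - - dens (x, t)) \<le> L1 * \<bar>y - x\<bar>"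
    if "0 < y" "y < 1" "y \<noteq> x" for y
  proof -
    have "\<bar>tail t y - tail t x + dens (x, t) * (y - x)\<bar> \<le> L1 * (y - x)\<^sup>2"
    proof (cases "x \<le> y")
      case True
      then show ?thesis using quad[of x y x] assms that by (simp add: abs_le_iff algebra_simps)
    next
      case False
      then show ?thesis using quad[of y x x] assms True that
        by (simp add: abs_le_iff algebra_simps power2_commute)
    qed
    moreover have "(tail t y - tail t x) / (y - x) - - dens (x, t)
        = (tail t y - tail t x + dens (x, t) * (y - x)) / (y - x)"
      using that by (simp add: field_simps)
    ultimately show ?thesis using that
      by (simp add: abs_divide divide_le_eq power2_eq_square)
  qed
  show ?thesis
    unfolding has_field_derivative_iff
  proof (rule LIM_zero_cancel, rule Lim_null_comparison)
    have "\<forall>\<^sub>F y in at x. y \<in> {0<..<1}"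
      using assms True by (intro eventually_at_in_open') auto
    moreover have "\<forall>\<^sub>F y in at x. y \<noteq> x" by (rule eventually_neq_at_within)
    ultimately show "\<forall>\<^sub>F y in at x. norm ((tail t y - tail t x) / (y - x) - - dens (x, t)) \<le> L1 * \<bar>y - x\<bar>"
      by eventually_elim (use bound in auto)
    show "((\<lambda>y. L1 * \<bar>y - x\<bar>) \<longlongrightarrow> 0) (at x)"
      by (rule tendsto_eq_intros | simp)+
  qed
qed

text \<open>Fubini: the mass to the right of the curve \<open>x\<^sub>1 = h x\<^sub>2\<close> is computed row by row.\<close>

lemma mass_eq_integral_tail:
  assumes [measurable]: "h \<in> borel_measurable borel" 
  shows "integrable (lebesgue_on X) (\<lambda>x. if h (snd x) < fst x then f x else 0)" (is ?int)
    and "(\<integral>x. (if h (snd x) < fst x then f x else 0) \<partial>lebesgue_on X) = (LBINT t. tail t (h t))"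
proof -
  let ?g = "\<lambda>x. if h (snd x) < fst x then dens x else 0"
  have meas: "?g \<in> borel_measurable lborel"
  proof -
    have [measurable]: "h \<in> borel_measurable borel" by fact
    have "?g \<in> borel_measurable (borel \<Otimes>\<^sub>M borel)" by measurable
    then show ?thesis by (simp add: borel_prod)
  qed
  have eq: "indicat_real X x * (if h (snd x) < fst x then f x else 0) = ?g x" for x
    by (auto simp: dens_def)
  have int: "integrable lborel ?g"
  proof (rule Bochner_Integration.integrable_bound)
    show "integrable lborel (\<lambda>x. K * indicat_real X x)"
    proof (intro integrable_mult_right integrable_real_indicator)
      have "emeasure lborel X \<le> emeasure lborel (cbox (0 :: real, 0 :: real) (1, 1))"
        by (intro emeasure_mono) (auto simp: X_def cbox_Pair_eq intro!: borel_closed closed_Times)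
      also have "\<dots> < \<infinity>" by (rule emeasure_lborel_cbox_finite)
      finally show "emeasure lborel X < \<infinity>" .
    qed auto
    show "AE x in lborel. norm (?g x) \<le> norm (K * indicat_real X x)"
    proof (rule AE_I2)
      fix x
      have "\<bar>dens x\<bar> \<le> K * indicat_real X x"
        using dens_nonneg[of x] dens_le[of x] by (cases "x \<in> X") (auto simp: dens_out)
      then show "norm (?g x) \<le> norm (K * indicat_real X x)" using K_pos by auto
    qed
  qed (rule meas)
  have "integrable lebesgue ?g" using int by (simp add: integrable_completion meas)
  then show ?int
    by (subst integrable_restrict_space) (simp_all add: eq sets_completionI)
  have "(\<integral>x. (if h (snd x) < fst x then f x else 0) \<partial>lebesgue_on X) = (\<integral>x. ?g x \<partial>lebesgue)"
    by (subst integral_restrict_space) (simp_all add: eq sets_completionI)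
  also have "\<dots> = (\<integral>x. ?g x \<partial>lborel)" by (rule integral_completion[OF meas])
  also have "\<dots> = (\<integral>(s, t). (if h t < s then dens (s, t) else 0) \<partial>(lborel \<Otimes>\<^sub>M lborel))"
    by (simp only: lborel_prod case_prod_unfold prod.collapse)
  also have "\<dots> = (LBINT t. tail t (h t))"
    unfolding tail_def using int by (subst lborel_pair.integral_snd) (simp_all only: lborel_prod case_prod_unfold prod.collapse)
  finally show "(\<integral>x. (if h (snd x) < fst x then f x else 0) \<partial>lebesgue_on X) = (LBINT t. tail t (h t))" .
qed

text \<open>The density of buyers along the line of slope \<open>m'\<close> below the vertex \<open>(a, \<tau>)\<close>, integrated with
  respect to the height: the rate at which demand reacts to a horizontal shift of this line.\<close>

definition line_mass :: "real \<Rightarrow> real \<Rightarrow> real \<Rightarrow> real" where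
  "line_mass a \<tau> m' = (LBINT t. (if t < \<tau> then dens (a + m' * (\<tau> - t), t) else 0))"

lemma tail_cut_lipschitz:
  "\<bar>tail t (cut a \<tau> S0 \<sigma> d t) - tail t (cut a \<tau> S0 \<sigma> e t)\<bar>
    \<le> K * \<bar>\<sigma>\<bar> * indicat_real {0..1} t * \<bar>d - e\<bar>"
proof (cases "t \<in> {0<..<1}")
  case True
  have "\<bar>tail t (cut a \<tau> S0 \<sigma> d t) - tail t (cut a \<tau> S0 \<sigma> e t)\<bar>
      \<le> K * \<bar>cut a \<tau> S0 \<sigma> d t - cut a \<tau> S0 \<sigma> e t\<bar>" by (rule tail_lipschitz)
  also have "\<dots> \<le> K * (\<bar>\<sigma>\<bar> * \<bar>d - e\<bar>)"
    using K_pos by (intro mult_left_mono cut_lipschitz) auto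
  finally show ?thesis using True by simp
qed (use K_pos in \<open>simp add: tail_eq_0\<close>)

text \<open>In the rows below the moved vertex the cut moves right with speed \<open>\<sigma>\<close>, in the rows above it does
  not move. The row of the vertex and the row in which the line leaves the square through its right
  side form a null set.\<close>

lemma mass_has_derivative:
  assumes e: "0 < a - S0 * e" and m: "0 < S0 + \<sigma>"
  shows "((\<lambda>e. LBINT t. tail t (cut a \<tau> S0 \<sigma> e t)) has_real_derivative
      - \<sigma> * line_mass (a - S0 * e) (\<tau> + e) (S0 + \<sigma>)) (at e)"
proof -
  let ?a = "a - S0 * e" and ?\<tau> = "\<tau> + e" and ?m = "S0 + \<sigma>"
  let ?\<psi> = "\<lambda>t. - \<sigma> * (if t < ?\<tau> then dens (?a + ?m * (?\<tau> - t), t) else 0)"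
  have [measurable]: "?\<psi> \<in> borel_measurable lborel" by measurable
  have "((\<lambda>e. LBINT t. tail t (cut a \<tau> S0 \<sigma> e t)) has_real_derivative (LBINT t. ?\<psi> t)) (at e)"
  proof (rule has_real_derivative_integral)
    show "integrable lborel (\<lambda>t. tail t (cut a \<tau> S0 \<sigma> d t))" for d
      by (rule integrable_tail_section) measurable
    show "integrable lborel (\<lambda>t. K * \<bar>\<sigma>\<bar> * indicat_real {0..1::real} t)"
      by (intro integrable_mult_right integrable_real_indicator) auto
    show "\<bar>tail t (cut a \<tau> S0 \<sigma> d t) - tail t (cut a \<tau> S0 \<sigma> e t)\<bar>
        \<le> K * \<bar>\<sigma>\<bar> * indicat_real {0..1} t * \<bar>d - e\<bar>" for d e t
      by (rule tail_cut_lipschitz)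
    show "AE t in lborel. ((\<lambda>e. tail t (cut a \<tau> S0 \<sigma> e t)) has_real_derivative ?\<psi> t) (at e)"
      using AE_lborel_singleton[of ?\<tau>] AE_lborel_singleton[of "?\<tau> - (1 - ?a) / ?m"]
    proof eventually_elim
      case (elim t)
      consider "t \<notin> {0<..<1}" | "t > ?\<tau>" "t \<in> {0<..<1}" | "t < ?\<tau>" "t \<in> {0<..<1}"
        using elim by force
      then show ?case
      proof cases
        case 1
        then have "dens (?a + ?m * (?\<tau> - t), t) = 0" by (intro dens_out) auto
        then show ?thesis using 1 by (simp add: tail_eq_0)
      next
        case 2
        have "\<forall>\<^sub>F d in nhds e. d < t - \<tau>"
          using 2 by (intro order_tendstoD(2)[OF filterlim_ident]) auto
        then have "\<forall>\<^sub>F d in nhds e. tail t (cut a \<tau> S0 \<sigma> d t) = tail t (a + S0 * (\<tau> - t))"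
          by eventually_elim (simp add: cut_def max_def)
        then show ?thesis using 2
          by (subst DERIV_cong_ev[of e e _ "\<lambda>_. tail t (a + S0 * (\<tau> - t))"]) auto
      next
        case 3
        let ?x = "?a + ?m * (?\<tau> - t)"
        have "0 < ?x" using 3 e m by (intro add_pos_pos) auto
        moreover have "?x \<noteq> 1" using elim(2) m by (auto simp: field_simps)
        ultimately have tail: "(tail t has_real_derivative - dens (?x, t)) (at ?x)"
          using 3 by (intro tail_has_derivative) auto
        have "\<forall>\<^sub>F d in nhds e. d > t - \<tau>"
          using 3 by (intro order_tendstoD(1)[OF filterlim_ident]) auto
        then have ev: "\<forall>\<^sub>F d in nhds e. tail t (cut a \<tau> S0 \<sigma> d t) = tail t (?x + \<sigma> * (d - e))"
          by eventually_elim (simp add: cut_def max_def algebra_simps)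
        have "((\<lambda>d. tail t (?x + \<sigma> * (d - e))) has_real_derivative - dens (?x, t) * \<sigma>) (at e)"
          by (rule DERIV_chain2[where f = "tail t"]) (auto intro!: tail derivative_eq_intros)
        then show ?thesis using 3 ev
          by (subst DERIV_cong_ev[of e e _ "\<lambda>d. tail t (?x + \<sigma> * (d - e))"]) (auto simp: mult.commute)
      qed
    qed
  qed simp
  also have "(LBINT t. ?\<psi> t) = - \<sigma> * line_mass ?a ?\<tau> ?m"
    unfolding line_mass_def by (rule integral_mult_right_zero)
  finally show ?thesis .
qed

lemma mass_lipschitz:
  "\<bar>(LBINT t. tail t (cut a \<tau> S0 \<sigma> d t)) - (LBINT t. tail t (cut a \<tau> S0 \<sigma> e t))\<bar> \<le> K * \<bar>\<sigma>\<bar> * \<bar>d - e\<bar>"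
proof -
  have int: "integrable lborel (\<lambda>t. tail t (cut a \<tau> S0 \<sigma> d t))" for d
    by (rule integrable_tail_section) measurable
  have "norm (LBINT t. tail t (cut a \<tau> S0 \<sigma> d t) - tail t (cut a \<tau> S0 \<sigma> e t))
      \<le> (LBINT t. K * \<bar>\<sigma>\<bar> * \<bar>d - e\<bar> * indicat_real {0..1::real} t)"
  proof (rule Bochner_Integration.integral_norm_bound_integral)
    show "norm (tail t (cut a \<tau> S0 \<sigma> d t) - tail t (cut a \<tau> S0 \<sigma> e t))
        \<le> K * \<bar>\<sigma>\<bar> * \<bar>d - e\<bar> * indicat_real {0..1} t" for t
      using tail_cut_lipschitz[of t a \<tau> S0 \<sigma> d e] by (simp add: mult_ac)
  qed (use int in auto)
  then show ?thesis using int by simp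
qed

end

section \<open>Two estimates for the strip between two lines\<close>

lemma has_integral_affine_Ioo:
  fixes p q \<beta> \<gamma> :: real
  assumes "p \<le> q"
  shows "has_bochner_integral lborel (\<lambda>t. indicator {p<..<q} t * (\<beta> + \<gamma> * t))
    (\<beta> * (q - p) + \<gamma> * (q\<^sup>2 - p\<^sup>2) / 2)"
proof -
  have "has_bochner_integral lborel (\<lambda>t. (\<beta> + \<gamma> * t) * indicator {p..q} t)
      ((\<beta> * q + \<gamma> * q\<^sup>2 / 2) - (\<beta> * p + \<gamma> * p\<^sup>2 / 2))"
    using assms by (intro has_bochner_integral_FTC_Icc_real) (auto intro!: derivative_eq_intros)
  moreover have "AE t in lborel. indicator {p<..<q} t * (\<beta> + \<gamma> * t) = (\<beta> + \<gamma> * t) * indicator {p..q} t"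
    using AE_lborel_singleton[of p] AE_lborel_singleton[of q]
    by eventually_elim (auto simp: indicator_def)
  ultimately show ?thesis
    by (subst has_bochner_integral_cong_AE[where g = "\<lambda>t. (\<beta> + \<gamma> * t) * indicator {p..q} t"])
      (auto simp: algebra_simps diff_divide_distrib)
qed

context bounded_density
begin

definition strip_mass :: "real \<Rightarrow> real \<Rightarrow> real \<Rightarrow> real \<Rightarrow> real" where
  "strip_mass a \<tau> m' m = (LBINT t. (if t < \<tau> then tail t (a + m' * (\<tau> - t)) - tail t (a + m * (\<tau> - t)) else 0))"

lemma integrable_strip: 
  "integrable lborel (\<lambda>t. if t < \<tau> then tail t (a + m' * (\<tau> - t)) - tail t (a + m * (\<tau> - t)) else 0)"
proof (rule integrable_bounded_support[where B = "2 * K" and p = 0 and q = 1])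
  show "\<bar>if t < \<tau> then tail t (a + m' * (\<tau> - t)) - tail t (a + m * (\<tau> - t)) else 0\<bar> \<le> 2 * K * indicator {0..1} t" for t
    using tail_bound[of t "a + m' * (\<tau> - t)"] tail_bound[of t "a + m * (\<tau> - t)"] K_pos by auto
qed measurable

lemma integrable_line: "integrable lborel (\<lambda>t. if t < \<tau> then dens (a + m' * (\<tau> - t), t) else 0)"
proof (rule integrable_bounded_support[where B = K and p = 0 and q = 1])
  show "(\<lambda>t. if t < \<tau> then dens (a + m' * (\<tau> - t), t) else 0) \<in> borel_measurable lborel"
    by measurable
  show "\<bar>if t < \<tau> then dens (a + m' * (\<tau> - t), t) else 0\<bar> \<le> K * indicator {0..1} t" for t
    using dens_section_le(2)[of "a + m' * (\<tau> - t)" t] K_pos by auto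
qed

text \<open>Write \<open>\<kappa> = a + m * \<tau>\<close> and \<open>\<kappa>' = a + m' * \<tau>\<close> for the levels of the two lines through \<open>(a, \<tau>)\<close>. In the
  row \<open>t\<close> the lines are \<open>(m - m') * (\<tau> - t)\<close> apart, so the densities on them and the markups
  \<open>\<kappa> - k\<close> and \<open>\<kappa>' - k'\<close> are comparable: the second markup exceeds the first by
  \<open>(k - k') - (m - m') * \<tau>\<close>. This gives a lower bound \<open>\<beta> - \<gamma> * (\<tau> - t)\<close> for the contribution of each
  row in which the left line is inside the square. In a row where the right line has left the
  square one has \<open>\<kappa> > 1\<close>, hence \<open>k \<le> \<kappa>\<close> by assumption, and the bound persists because the term that
  disappears would only have lowered the contribution.\<close>

lemma bottom_estimate:
  assumes a: "0 < a" "a < 1" and \<tau>: "0 < \<tau>" "\<tau> < 1" and m: "0 < m'" "m' < m" and k: "0 \<le> k"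
    and cond: "(m - m') * (3 / 2 * K + L1 / 2 * (1 + m + k)) < \<alpha> * (k - k')"
    and "k \<le> a + m * \<tau> \<or> a + m * \<tau> \<le> 1"
  shows "strip_mass a \<tau> m' m + (a + m * \<tau> - k) * line_mass a \<tau> m
    < (a + m' * \<tau> - k') * line_mass a \<tau> m'"
proof -
  define \<kappa> where "\<kappa> = a + m * \<tau>"
  define \<kappa>' where "\<kappa>' = a + m' * \<tau>"
  define g where "g t = a + m * (\<tau> - t)" for t
  define g' where "g' t = a + m' * (\<tau> - t)" for t
  \<comment> \<open>below row \<open>t1\<close> the left line, and with it the whole strip, is outside the square\<close>
  define t1 where "t1 = max 0 (\<tau> - (1 - a) / m')"
  define \<beta> where "\<beta> = \<alpha> * (k - k') - K * (m - m')"
  define \<gamma> where "\<gamma> = (m - m') * (L1 * (1 + m + k) + K)"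
  let ?R = "\<lambda>t. (\<kappa>' - k') * (if t < \<tau> then dens (g' t, t) else 0)
      - (\<kappa> - k) * (if t < \<tau> then dens (g t, t) else 0)
      - (if t < \<tau> then tail t (g' t) - tail t (g t) else 0)"
  let ?low = "\<lambda>t. indicator {t1<..<\<tau>} t * ((\<beta> - \<gamma> * \<tau>) + \<gamma> * t)"
  have "0 \<le> (m - m') * (3 / 2 * K + L1 / 2 * (1 + m + k))"
    using m k K_pos L1_nonneg by (intro mult_nonneg_nonneg add_nonneg_nonneg) auto
  then have \<Delta>k: "0 < k - k'" using cond \<alpha>_pos by (smt (verit) zero_less_mult_pos)
  have "m * \<tau> \<le> m * 1" "0 < m * \<tau>" using m \<tau> by (auto intro: mult_left_mono)
  then have \<kappa>: "0 < \<kappa>" "\<kappa> \<le> 1 + m" using a by (auto simp: \<kappa>_def)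
  then have abs\<kappa>: "\<bar>\<kappa> - k\<bar> \<le> 1 + m + k" using k m by auto
  have pointwise: "?low t \<le> ?R t" for t
  proof (cases "t1 < t \<and> t < \<tau>")
    case True
    then have t: "0 < t" "t < \<tau>" "\<tau> - (1 - a) / m' < t" by (auto simp: t1_def)
    have g': "a < g' t" "g' t < 1" using t m by (auto simp: g'_def field_simps)
    have gg': "g t - g' t = (m - m') * (\<tau> - t)" by (simp add: g_def g'_def algebra_simps)
    then have le: "g' t \<le> g t" using m t by (smt (verit) mult_nonneg_nonneg)
    have X': "(g' t, t) \<in> X" using g' a t \<tau> by simp
    have f': "\<alpha> \<le> f (g' t, t)" "f (g' t, t) \<le> K" using f_ge f_le X' by auto
    have "tail t (g' t) - tail t (g t) \<le> K * (min (g t) 1 - min (g' t) 1)"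
      by (rule tail_diff_bounds(2)[OF le])
    also have "\<dots> \<le> K * (g t - g' t)" using K_pos g' by (intro mult_left_mono) auto
    finally have strip: "tail t (g' t) - tail t (g t) \<le> K * ((m - m') * (\<tau> - t))" using gg' by simp
    have "(k - k') * \<alpha> \<le> (k - k') * f (g' t, t)" using \<Delta>k f' by (intro mult_left_mono) auto
    moreover have "\<tau> * (m - m') * f (g' t, t) \<le> 1 * (m - m') * K"
      using \<tau> m f' \<alpha>_pos by (intro mult_mono) auto
    moreover have "(\<kappa>' - k' - \<kappa> + k) * f (g' t, t) = (k - k') * f (g' t, t) - \<tau> * (m - m') * f (g' t, t)"
      by (simp add: \<kappa>_def \<kappa>'_def algebra_simps)
    ultimately have main: "\<beta> \<le> (\<kappa>' - k' - \<kappa> + k) * f (g' t, t)"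
      by (simp add: \<beta>_def algebra_simps)
    have Rlow: "\<beta> - (1 + m + k) * (L1 * ((m - m') * (\<tau> - t)))
        \<le> (\<kappa>' - k') * dens (g' t, t) - (\<kappa> - k) * dens (g t, t)"
    proof (cases "g t < 1")
      case True
      then have X: "(g t, t) \<in> X" using g' le a t \<tau> by simp
      have "\<bar>(\<kappa> - k) * (f (g' t, t) - f (g t, t))\<bar> \<le> (1 + m + k) * (L1 * \<bar>g' t - g t\<bar>)"
        unfolding abs_mult using lip1[OF X' X] abs\<kappa> m k by (intro mult_mono) auto
      then have "\<bar>(\<kappa> - k) * (f (g' t, t) - f (g t, t))\<bar> \<le> (1 + m + k) * (L1 * ((m - m') * (\<tau> - t)))"
        using gg' le by simp
      moreover have "(\<kappa>' - k') * dens (g' t, t) - (\<kappa> - k) * dens (g t, t)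
          = (\<kappa>' - k' - \<kappa> + k) * f (g' t, t) + (\<kappa> - k) * (f (g' t, t) - f (g t, t))"
        using X X' by (simp add: dens_in algebra_simps)
      ultimately show ?thesis using main by linarith
    next
      case False
      then have "1 < \<kappa>" using t m by (smt (verit) g_def \<kappa>_def mult_strict_left_mono)
      then have "k \<le> \<kappa>" using assms(9) by (auto simp: \<kappa>_def)
      then have "(\<kappa>' - k' - \<kappa> + k) * f (g' t, t) \<le> (\<kappa>' - k') * f (g' t, t)"
        using f' \<alpha>_pos by (intro mult_right_mono) auto
      moreover have "0 \<le> (1 + m + k) * (L1 * ((m - m') * (\<tau> - t)))"
        using m k t L1_nonneg by (intro mult_nonneg_nonneg) auto
      ultimately show ?thesis using main X' False by (simp add: dens_in dens_out)
    qed
    have "\<beta> - \<gamma> * (\<tau> - t) = \<beta> - (1 + m + k) * (L1 * ((m - m') * (\<tau> - t))) - K * ((m - m') * (\<tau> - t))"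
      by (simp add: \<gamma>_def algebra_simps)
    then show ?thesis using Rlow strip True by (simp add: algebra_simps)
  next
    case False
    show ?thesis
    proof (cases "t < \<tau> \<and> 0 < t")
      case True
      then have "t \<le> \<tau> - (1 - a) / m'" using False by (auto simp: t1_def)
      then have "1 \<le> g' t" using m by (simp add: g'_def field_simps)
      moreover have "g' t \<le> g t"
        unfolding g_def g'_def using m True by (intro add_left_mono mult_right_mono) auto
      ultimately show ?thesis using False by (auto simp: dens_out tail_eq_0)
    qed (use False in \<open>auto simp: dens_out tail_eq_0\<close>)
  qed
  have int: "integrable lborel ?R"
    unfolding g_def g'_def
    by (intro Bochner_Integration.integrable_diff integrable_mult_right integrable_line integrable_strip)
  have t1: "0 \<le> t1" "t1 < \<tau>" using \<tau> a m by (auto simp: t1_def)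
  note low = has_integral_affine_Ioo[OF less_imp_le[OF t1(2)], of "\<beta> - \<gamma> * \<tau>" \<gamma>]
  have "0 < (\<tau> - t1) * (\<beta> - \<gamma> * (\<tau> - t1) / 2)"
  proof (rule mult_pos_pos)
    have "\<gamma> * (\<tau> - t1) \<le> \<gamma> * 1"
      using t1 \<tau> m k K_pos L1_nonneg unfolding \<gamma>_def by (intro mult_left_mono mult_nonneg_nonneg add_nonneg_nonneg) auto
    moreover have "\<gamma> / 2 < \<beta>"
    proof -
      have "(m - m') * (3 / 2 * K + L1 / 2 * (1 + m + k)) = \<gamma> / 2 + K * (m - m')"
        by (simp add: \<gamma>_def field_simps)
      then show ?thesis using cond by (simp add: \<beta>_def)
    qed
    ultimately show "0 < \<beta> - \<gamma> * (\<tau> - t1) / 2" by simp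
  qed (use t1 in simp)
  also have "\<dots> = (\<beta> - \<gamma> * \<tau>) * (\<tau> - t1) + \<gamma> * (\<tau>\<^sup>2 - t1\<^sup>2) / 2"
    by (simp add: power2_eq_square field_simps)
  also have "\<dots> = (LBINT t. ?low t)" using low by (simp add: has_bochner_integral_iff)
  also have "\<dots> \<le> (LBINT t. ?R t)"
    using low int pointwise by (intro integral_mono) (auto simp: has_bochner_integral_iff)
  also have "\<dots> = (\<kappa>' - k') * line_mass a \<tau> m' - (\<kappa> - k) * line_mass a \<tau> m - strip_mass a \<tau> m' m"
    unfolding line_mass_def strip_mass_def g_def g'_def
    by (simp add: integrable_line integrable_strip)
  finally show ?thesis by (simp add: \<kappa>_def \<kappa>'_def)
qed

text \<open>Substitution of the horizontal coordinate \<open>s = a + m' * (\<tau> - t)\<close> for the height.\<close>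

lemma line_mass_columns:
  assumes "0 < m'"
  shows "line_mass a \<tau> m' = (LBINT s. (if a < s then dens (s, \<tau> - (s - a) / m') else 0)) / m'"
    and "integrable lborel (\<lambda>s. if a < s then dens (s, \<tau> - (s - a) / m') else 0)"
proof -
  let ?g = "\<lambda>t. if t < \<tau> then dens (a + m' * (\<tau> - t), t) else 0"
  have eq: "?g ((\<tau> + a / m') + (- 1 / m') * s) = (if a < s then dens (s, \<tau> - (s - a) / m') else 0)" for s
  proof -
    have t: "(\<tau> + a / m') + (- 1 / m') * s = \<tau> - (s - a) / m'" by (simp add: diff_divide_distrib)
    have "a + m' * (\<tau> - (\<tau> - (s - a) / m')) = s" "\<tau> - (s - a) / m' < \<tau> \<longleftrightarrow> a < s"
      using assms by (simp_all add: zero_less_divide_iff)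
    then show ?thesis unfolding t by simp
  qed
  have "line_mass a \<tau> m' = \<bar>- 1 / m'\<bar> *\<^sub>R (LBINT s. ?g ((\<tau> + a / m') + (- 1 / m') * s))"
    unfolding line_mass_def using assms by (intro lborel_integral_real_affine) auto
  then show "line_mass a \<tau> m' = (LBINT s. (if a < s then dens (s, \<tau> - (s - a) / m') else 0)) / m'"
    unfolding eq using assms by simp
  have "integrable lborel (\<lambda>s. ?g ((\<tau> + a / m') + (- 1 / m') * s))"
    using assms by (intro lborel_integrable_real_affine integrable_line) auto
  then show "integrable lborel (\<lambda>s. if a < s then dens (s, \<tau> - (s - a) / m') else 0)"
    unfolding eq .
qed

text \<open>Since the right line leaves the square through its right side, the strip lies in the triangle
  that the two lines form with the vertical line \<open>x\<^sub>1 = 1\<close>.\<close>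

lemma strip_mass_le:
  assumes a: "a < 1" and \<tau>: "\<tau> < 1" and m: "0 < m'" "m' < m" and right: "1 \<le> a + m * \<tau>"
  shows "strip_mass a \<tau> m' m \<le> K * (1 - a)\<^sup>2 / 2 * (1 / m' - 1 / m)"
proof -
  define D where "D = 1 - a"
  let ?m = "\<lambda>t. if t < \<tau> then tail t (a + m' * (\<tau> - t)) - tail t (a + m * (\<tau> - t)) else 0"
  \<comment> \<open>for \<open>t < \<tau>\<close> this is the length of the row segment from the line of slope \<open>m\<close> to the right side\<close>
  let ?u = "\<lambda>m t. indicator {\<tau> - D / m<..<\<tau>} t * ((D - m * \<tau>) + m * t)"
  have D: "0 < D" using a by (simp add: D_def)
  have u: "has_bochner_integral lborel (?u m) (D\<^sup>2 / (2 * m))" if "0 < m" for m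
  proof -
    have "has_bochner_integral lborel (?u m)
        ((D - m * \<tau>) * (\<tau> - (\<tau> - D / m)) + m * (\<tau>\<^sup>2 - (\<tau> - D / m)\<^sup>2) / 2)"
      using that D by (intro has_integral_affine_Ioo) simp
    also have "(D - m * \<tau>) * (\<tau> - (\<tau> - D / m)) + m * (\<tau>\<^sup>2 - (\<tau> - D / m)\<^sup>2) / 2 = D\<^sup>2 / (2 * m)"
      using that by (simp add: power2_eq_square field_simps)
    finally show ?thesis .
  qed
  have "strip_mass a \<tau> m' m \<le> (LBINT t. K * (?u m' t - ?u m t))"
    unfolding strip_mass_def
  proof (rule integral_mono)
    show "integrable lborel ?m" by (rule integrable_strip)
    show "integrable lborel (\<lambda>t. K * (?u m' t - ?u m t))"
      using u m by (intro integrable_mult_right Bochner_Integration.integrable_diff)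
        (auto simp: has_bochner_integral_iff)
    fix t
    have u_eq: "?u m t = 1 - min (a + m * (\<tau> - t)) 1" if "t < \<tau>" "0 < m" for m
      using that by (auto simp: indicator_def D_def min_def field_simps)
    consider "t \<ge> \<tau>" | "t < \<tau>" "0 < t" | "t < \<tau>" "t \<le> 0" by linarith
    then show "?m t \<le> K * (?u m' t - ?u m t)"
    proof cases
      case 2
      have "a + m' * (\<tau> - t) \<le> a + m * (\<tau> - t)" using m 2 by (intro add_left_mono mult_right_mono) auto
      note strip = tail_diff_bounds(2)[OF this, of t]
      have "?u m' t - ?u m t = min (a + m * (\<tau> - t)) 1 - min (a + m' * (\<tau> - t)) 1"
        using 2 m by (simp only: u_eq)
      then show ?thesis using strip 2 by (simp only: if_True)
    next
      case 3
      have "1 \<le> a + m * (\<tau> - t)" using right m 3 by (smt (verit) mult_left_mono)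
      then have u: "?u m t = 0" "0 \<le> ?u m' t" using 3 m by (simp_all only: u_eq)
      have "0 \<le> K * (?u m' t - ?u m t)" unfolding u(1) using u(2) K_pos by simp
      moreover have "?m t = 0" using 3 by (simp add: tail_eq_0)
      ultimately show ?thesis by simp
    qed auto
  qed
  also have "\<dots> = K * (D\<^sup>2 / (2 * m') - D\<^sup>2 / (2 * m))"
    using u[of m] u[of m'] m by (simp add: has_bochner_integral_iff)
  finally show ?thesis by (simp add: D_def algebra_simps)
qed

text \<open>The counterpart of the preceding estimate by columns. Measured by the height at \<open>x\<^sub>1 = 0\<close> the lines
  have levels \<open>l = (a + m * \<tau>) / m\<close> and \<open>l' = (a + m' * \<tau>) / m'\<close> and unit costs \<open>G = k / m\<close> and
  \<open>G' = k' / m'\<close>. The column \<open>s\<close> is met by both lines for \<open>a < s < a + D1\<close>. Further to the right at most the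
  upper line is met, and as its markup \<open>l - G\<close> is negative it contributes with the right sign. The
  mass of the strip is bounded by that of a triangle of width \<open>D = 1 - a\<close>, where
  \<open>D \<le> m\<close> and \<open>D \<le> D1 * (m / m')\<close> because the upper line reaches \<open>x\<^sub>1 = 1\<close> above the bottom side.\<close>

lemma side_estimate:
  assumes a: "0 < a" "a < 1" and \<tau>: "0 < \<tau>" "\<tau> < 1" and m: "0 < m'" "m' < m" and k: "0 \<le> k"
    and mono: "k' / m' < k / m"
    and cond: "m / 2 * (1 / m' - 1 / m) * (K * (2 + m / m') + L2 * (1 + 2 / m' + k / m))
        < \<alpha> * ((1 / m' - 1 / m) + (k / m - k' / m'))"
    and below: "a + m * \<tau> < k" and right: "1 < a + m * \<tau>"
  shows "strip_mass a \<tau> m' m + (a + m * \<tau> - k) * line_mass a \<tau> m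
    < (a + m' * \<tau> - k') * line_mass a \<tau> m'"
proof -
  define \<gamma> where "\<gamma> s = \<tau> - (s - a) / m" for s
  define \<gamma>' where "\<gamma>' s = \<tau> - (s - a) / m'" for s
  define G where "G = k / m"
  define G' where "G' = k' / m'"
  define l where "l = a / m + \<tau>"
  define l' where "l' = a / m' + \<tau>"
  define D where "D = 1 - a"
  \<comment> \<open>the lower line leaves the square at \<open>s = a + D1\<close>, through its right side or its bottom\<close>
  define D1 where "D1 = min D (m' * \<tau>)"
  define \<delta> where "\<delta> = 1 / m' - 1 / m"
  let ?R = "\<lambda>s. (l' - G') * (if a < s then dens (s, \<gamma>' s) else 0)
      + (G - l) * (if a < s then dens (s, \<gamma> s) else 0)"
  define \<beta> where "\<beta> = \<alpha> * (a * \<delta> + (G - G'))"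
  let ?low = "\<lambda>s. indicator {a<..<a + D1} s * ((\<beta> + G * L2 * \<delta> * a) + (- G * L2 * \<delta>) * s)"
  have mpos: "0 < m" using m by simp
  have \<delta>: "0 < \<delta>" using m by (simp add: \<delta>_def field_simps)
  have Gl: "0 < G - l" "l \<ge> 0" "0 \<le> G"
    using below mpos a \<tau> k by (auto simp: G_def l_def field_simps)
  have D: "0 < D" "D < m * \<tau>" "D1 \<le> D" "0 < D1" 
    using a right m \<tau> by (auto simp: D_def D1_def)
  have DS: "D \<le> m" using D(2) \<tau> mpos by (smt (verit) mult_left_le)
  have DD1: "D \<le> D1 * (m / m')"
  proof (cases "D \<le> m' * \<tau>")
    case True
    then have "D1 = D" by (simp add: D1_def)
    moreover have "D * 1 \<le> D * (m / m')" using D m by (intro mult_left_mono) auto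
    ultimately show ?thesis by simp
  next
    case False
    then have "D1 * (m / m') = m * \<tau>" using m by (simp add: D1_def)
    then show ?thesis using D by simp
  qed
  have pointwise: "?low s \<le> ?R s" for s
  proof (cases "a < s \<and> s < a + D1")
    case True
    then have s: "a < s" "s < 1" "s - a < m' * \<tau>" by (auto simp: D1_def D_def)
    have gg: "\<gamma> s - \<gamma>' s = \<delta> * (s - a)" by (simp add: \<gamma>_def \<gamma>'_def \<delta>_def algebra_simps)
    have pos: "0 < \<gamma>' s" using s m by (simp add: \<gamma>'_def field_simps)
    have le: "\<gamma>' s \<le> \<gamma> s" using gg \<delta> s by (smt (verit) mult_nonneg_nonneg)
    have "0 < (s - a) / m" using s mpos by simp
    then have lt: "\<gamma> s < 1" using \<tau> unfolding \<gamma>_def by linarith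
    have X: "(s, \<gamma> s) \<in> X" "(s, \<gamma>' s) \<in> X" using s a lt le pos by auto
    have "(a * \<delta> + (G - G')) * \<alpha> \<le> (a * \<delta> + (G - G')) * f (s, \<gamma>' s)"
      using f_ge[OF X(2)] a \<delta> mono by (intro mult_left_mono) (auto simp: G_def G'_def intro!: add_nonneg_nonneg)
    moreover have "\<bar>(G - l) * (f (s, \<gamma> s) - f (s, \<gamma>' s))\<bar> \<le> G * (L2 * \<bar>\<gamma> s - \<gamma>' s\<bar>)"
      unfolding abs_mult using lip2[OF X] Gl by (intro mult_mono) auto
    moreover have "(l' - G') * f (s, \<gamma>' s) + (G - l) * f (s, \<gamma> s)
       = (a * \<delta> + (G - G')) * f (s, \<gamma>' s) + (G - l) * (f (s, \<gamma> s) - f (s, \<gamma>' s))"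
      by (simp add: l_def l'_def \<delta>_def algebra_simps)
    moreover have "\<bar>\<gamma> s - \<gamma>' s\<bar> = \<delta> * (s - a)" using gg le by simp
    ultimately have "\<beta> - G * (L2 * (\<delta> * (s - a))) \<le> (l' - G') * f (s, \<gamma>' s) + (G - l) * f (s, \<gamma> s)"
      by (simp add: \<beta>_def algebra_simps)
    then show ?thesis using True X by (simp add: dens_in algebra_simps)
  next
    case False
    have "dens (s, \<gamma>' s) = 0" if "a < s"
    proof (rule dens_out)
      have "1 \<le> s \<or> m' * \<tau> \<le> s - a" using False that by (auto simp: D1_def D_def)
      then show "(s, \<gamma>' s) \<notin> X" using m by (auto simp: \<gamma>'_def field_simps)
    qed
    then show ?thesis using False Gl dens_nonneg[of "(s, \<gamma> s)"] by auto
  qed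
  have int: "integrable lborel ?R"
    unfolding \<gamma>_def \<gamma>'_def using m mpos
    by (intro Bochner_Integration.integrable_add integrable_mult_right line_mass_columns(2)) auto
  have "a \<le> a + D1" using D by simp
  note low = has_integral_affine_Ioo[OF this, of "\<beta> + G * L2 * \<delta> * a" "- G * L2 * \<delta>"]
  have "D1 * \<beta> - G * L2 * \<delta> * D1\<^sup>2 / 2
      = (\<beta> + G * L2 * \<delta> * a) * (a + D1 - a) + - G * L2 * \<delta> * ((a + D1)\<^sup>2 - a\<^sup>2) / 2"
    by (simp add: power2_eq_square field_simps)
  also have "\<dots> = (LBINT s. ?low s)" using low by (simp add: has_bochner_integral_iff)
  also have "\<dots> \<le> (LBINT s. ?R s)"
    using low int pointwise by (intro integral_mono) (auto simp: has_bochner_integral_iff)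
  also have "\<dots> = (l' - G') * (m' * line_mass a \<tau> m') + (G - l) * (m * line_mass a \<tau> m)"
    using m mpos line_mass_columns(2)[of m a \<tau>] line_mass_columns(2)[of m' a \<tau>]
    unfolding \<gamma>_def \<gamma>'_def by (simp add: line_mass_columns(1))
  also have "\<dots> = (a + m' * \<tau> - k') * line_mass a \<tau> m' - (a + m * \<tau> - k) * line_mass a \<tau> m"
    using m mpos by (simp add: l_def l'_def G_def G'_def field_simps)
  finally have boundary: "D1 * \<beta> - G * L2 * \<delta> * D1\<^sup>2 / 2
      \<le> (a + m' * \<tau> - k') * line_mass a \<tau> m' - (a + m * \<tau> - k) * line_mass a \<tau> m" .
  have strip: "strip_mass a \<tau> m' m \<le> K * D\<^sup>2 / 2 * \<delta>"
    using strip_mass_le[of a \<tau> m' m] a \<tau> m right by (simp add: D_def \<delta>_def)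
  have "K * D\<^sup>2 / 2 * \<delta> < D1 * \<beta> - G * L2 * \<delta> * D1\<^sup>2 / 2"
  proof -
    have "D1 * (m / 2 * \<delta> * (K * (2 + m / m') + L2 * (1 + 2 / m' + G))) < D1 * (\<alpha> * (\<delta> + (G - G')))"
      using cond D by (intro mult_strict_left_mono) (auto simp: \<delta>_def G_def G'_def)
    moreover have "D1 * (\<alpha> * (\<delta> + (G - G'))) = D1 * \<beta> + \<delta> * (D1 * (\<alpha> * D))"
      by (simp add: \<beta>_def D_def algebra_simps)
    moreover have "\<delta> * (D1 * (\<alpha> * D)) \<le> \<delta> * (D1 * (K * m))"
      using \<delta> D DS \<alpha>_le_K \<alpha>_pos by (intro mult_left_mono mult_mono) auto
    moreover have "\<delta> / 2 * (G * L2 * (D1 * D1)) \<le> \<delta> / 2 * (G * L2 * (D1 * m))"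
      using \<delta> D DS Gl L2_nonneg by (intro mult_left_mono) auto
    moreover have "\<delta> / 2 * (K * (D * D)) \<le> \<delta> / 2 * (K * (m * (D1 * (m / m'))))"
      using \<delta> D DS DD1 K_pos mpos by (intro mult_left_mono mult_mono) auto
    moreover have "0 \<le> D1 * (m / 2 * \<delta> * (L2 * (1 + 2 / m')))"
      using D mpos \<delta> L2_nonneg m by (intro mult_nonneg_nonneg) auto
    ultimately show ?thesis by (simp add: power2_eq_square algebra_simps)
  qed
  then show ?thesis using boundary strip by linarith
qed

end

section \<open>Moving the vertex increases the profit of a block\<close>

lemma strict_mono_interval:
  fixes H :: "nat \<Rightarrow> real"
  assumes "\<And>q. p < q \<Longrightarrow> q \<le> r \<Longrightarrow> H (q - 1) < H q" and "p \<le> i" "i < j" "j \<le> r"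
  shows "H i < H j"
  using assms(3,4)
proof (induction j)
  case (Suc j)
  have "H j < H (Suc j)" using assms(1)[of "Suc j"] assms(2) Suc.prems by simp
  then show ?case using Suc by (cases "i = j") auto
qed simp

text \<open>The double sum of the nonnegative terms \<open>w i * w j * (\<sigma> i - \<sigma> j) * (H i - H j)\<close> is twice the total
  weight times the sum in question, as the mean of \<open>\<sigma>\<close> is zero.\<close>

lemma chebyshev_sum_pos:
  fixes w \<sigma> H :: "nat \<Rightarrow> real"
  assumes "p < r" and w: "\<And>q. q \<in> {p..r} \<Longrightarrow> 0 < w q" and zero: "(\<Sum>q=p..r. w q * \<sigma> q) = 0"
    and \<sigma>: "\<And>i j. p \<le> i \<Longrightarrow> i < j \<Longrightarrow> j \<le> r \<Longrightarrow> \<sigma> i < \<sigma> j"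
    and H: "\<And>i j. p \<le> i \<Longrightarrow> i < j \<Longrightarrow> j \<le> r \<Longrightarrow> H i < H j"
  shows "0 < (\<Sum>q=p..r. w q * \<sigma> q * H q)"
proof -
  let ?I = "{p..r}"
  let ?T = "\<lambda>i j. w i * w j * ((\<sigma> i - \<sigma> j) * (H i - H j))"
  have nonneg: "0 \<le> ?T i j" if "i \<in> ?I" "j \<in> ?I" for i j
  proof -
    have "0 \<le> (\<sigma> i - \<sigma> j) * (H i - H j)"
      using \<sigma>[of i j] \<sigma>[of j i] H[of i j] H[of j i] that
      by (cases i j rule: linorder_cases) (auto intro: mult_nonneg_nonneg mult_nonpos_nonpos)
    then show ?thesis using w[OF that(1)] w[OF that(2)] by simp
  qed
  have "0 < (\<sigma> p - \<sigma> r) * (H p - H r)"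
    using \<sigma>[of p r] H[of p r] \<open>p < r\<close> by (intro mult_neg_neg) auto
  moreover have "0 < w p * w r" using w[of p] w[of r] \<open>p < r\<close> by simp
  ultimately have "0 < ?T p r" by (rule mult_pos_pos[rotated])
  have inner: "0 < (\<Sum>j\<in>?I. ?T p j)"
  proof (rule sum_pos2)
    show "r \<in> ?I" "\<And>j. j \<in> ?I \<Longrightarrow> 0 \<le> ?T p j" using \<open>p < r\<close> nonneg by auto
  qed (use \<open>0 < ?T p r\<close> in auto)
  have "0 < (\<Sum>i\<in>?I. \<Sum>j\<in>?I. ?T i j)"
  proof (rule sum_pos2)
    show "p \<in> ?I" "\<And>i. i \<in> ?I \<Longrightarrow> 0 \<le> (\<Sum>j\<in>?I. ?T i j)"
      using \<open>p < r\<close> nonneg by (auto intro!: sum_nonneg)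
  qed (use inner in auto)
  also have "\<dots> = (\<Sum>i\<in>?I. \<Sum>j\<in>?I. w j * (w i * \<sigma> i * H i) - (w i * \<sigma> i) * (w j * H j)
      - (w i * H i) * (w j * \<sigma> j) + w i * (w j * \<sigma> j * H j))"
    by (intro sum.cong refl) (simp add: algebra_simps)
  also have "\<dots> = 2 * (\<Sum>j\<in>?I. w j) * (\<Sum>q\<in>?I. w q * \<sigma> q * H q)"
    by (simp add: sum.distrib sum_subtractf flip: sum_distrib_left sum_distrib_right)
      (simp add: zero)
  finally have "0 < 2 * (\<Sum>j\<in>?I. w j) * (\<Sum>q\<in>?I. w q * \<sigma> q * H q)" .
  moreover have "0 \<le> (\<Sum>j\<in>?I. w j)" using w by (intro sum_nonneg) (auto intro: less_imp_le)
  ultimately show ?thesis by (auto simp: zero_less_mult_iff)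
qed

context bounded_density
begin

definition cut_mass :: "real \<Rightarrow> real \<Rightarrow> real \<Rightarrow> real \<Rightarrow> real \<Rightarrow> real" where
  "cut_mass a \<tau> S0 \<sigma> e = (LBINT t. tail t (cut a \<tau> S0 \<sigma> e t))"

lemma cut_mass_diff:
  "cut_mass a \<tau> S0 \<sigma>' e - cut_mass a \<tau> S0 \<sigma> e = strip_mass (a - S0 * e) (\<tau> + e) (S0 + \<sigma>') (S0 + \<sigma>)"
proof -
  have "cut_mass a \<tau> S0 \<sigma>' e - cut_mass a \<tau> S0 \<sigma> e
      = (LBINT t. tail t (cut a \<tau> S0 \<sigma>' e t) - tail t (cut a \<tau> S0 \<sigma> e t))"
    unfolding cut_mass_def by (subst Bochner_Integration.integral_diff) (simp_all add: integrable_tail_section)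
  also have "\<dots> = strip_mass (a - S0 * e) (\<tau> + e) (S0 + \<sigma>') (S0 + \<sigma>)"
    unfolding strip_mass_def
    by (intro Bochner_Integration.integral_cong) (auto simp: cut_below cut_above not_less)
  finally show ?thesis .
qed

text \<open>The sums are the profits on the block of lines \<open>p, ..., r\<close>, with widths \<open>w\<close>, slopes \<open>m\<close>, unit costs
  \<open>k\<close> and levels \<open>\<kappa>\<close>, before and after the vertex has moved by \<open>\<epsilon>\<close>. For \<open>0 < e < \<epsilon>\<close> the vertex lies in the
  open square, so the two estimates above apply and the profit has a positive derivative; at
  \<open>e = 0\<close>, where the vertex may be on the boundary, only continuity is used.\<close>

lemma vertex_profit_increases:
  fixes w m k \<kappa> :: "nat \<Rightarrow> real" and p r :: nat
  assumes "p < r" and w: "\<And>q. q \<in> {p..r} \<Longrightarrow> 0 < w q"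
    and mean: "(\<Sum>q=p..r. w q * (m q - S0)) = 0" and "0 < S0"
    and pos: "\<And>q. q \<in> {p..r} \<Longrightarrow> 0 < m q \<and> 0 \<le> k q"
    and m: "\<And>q. p < q \<Longrightarrow> q \<le> r \<Longrightarrow> m (q - 1) < m q"
    and unit_cost: "\<And>q. p < q \<Longrightarrow> q \<le> r \<Longrightarrow> k (q - 1) / m (q - 1) < k q / m q"
    and bottom: "\<And>q. p < q \<Longrightarrow> q \<le> r \<Longrightarrow>
      (m q - m (q - 1)) * (3 / 2 * K + L1 / 2 * (1 + m q + k q)) < \<alpha> * (k q - k (q - 1))"
    and side: "\<And>q. p < q \<Longrightarrow> q \<le> r \<Longrightarrow>
      m q / 2 * (1 / m (q - 1) - 1 / m q) * (K * (2 + m q / m (q - 1)) + L2 * (1 + 2 / m (q - 1) + k q / m q))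
      < \<alpha> * ((1 / m (q - 1) - 1 / m q) + (k q / m q - k (q - 1) / m (q - 1)))"
    and \<kappa>: "\<And>q. q \<in> {p..r} \<Longrightarrow> \<kappa> q = a + m q * \<tau>"
    and a: "a \<le> 1" and \<tau>: "0 \<le> \<tau>" and \<epsilon>: "0 < \<epsilon>" "0 < a - S0 * \<epsilon>" "\<tau> + \<epsilon> < 1"
  shows "(\<Sum>q=p..r. w q * (\<kappa> q - k q) * cut_mass a \<tau> S0 (m q - S0) 0)
    < (\<Sum>q=p..r. w q * (\<kappa> q + \<epsilon> * (m q - S0) - k q) * cut_mass a \<tau> S0 (m q - S0) \<epsilon>)"
proof -
  let ?Q = "\<lambda>e. \<Sum>q=p..r. w q * (\<kappa> q + e * (m q - S0) - k q) * cut_mass a \<tau> S0 (m q - S0) e"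
  have "?Q 0 < ?Q \<epsilon>"
  proof (rule DERIV_pos_imp_increasing_open[OF \<epsilon>(1)])
    fix e assume e: "0 < e" "e < \<epsilon>"
    let ?a = "a - S0 * e" and ?\<tau> = "\<tau> + e"
    have "S0 * e < S0 * \<epsilon>" "0 < S0 * e" using e \<open>0 < S0\<close> by auto
    then have v: "0 < ?a" "?a < 1" "0 < ?\<tau>" "?\<tau> < 1" using e \<epsilon> a \<tau> by auto
    define H where "H q = cut_mass a \<tau> S0 (m q - S0) e - (\<kappa> q + e * (m q - S0) - k q) * line_mass ?a ?\<tau> (m q)" for q
    have "((\<lambda>e. cut_mass a \<tau> S0 (m q - S0) e) has_real_derivative
        - (m q - S0) * line_mass ?a ?\<tau> (m q)) (at e)" if "q \<in> {p..r}" for q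
      using mass_has_derivative[of a S0 e "m q - S0" \<tau>] v pos[OF that] by (simp add: cut_mass_def[abs_def])
    note deriv = this
    have "(?Q has_real_derivative (\<Sum>q=p..r. w q * (m q - S0) * H q)) (at e)"
    proof (rule DERIV_sum)
      fix q assume q: "q \<in> {p..r}"
      show "((\<lambda>e. w q * (\<kappa> q + e * (m q - S0) - k q) * cut_mass a \<tau> S0 (m q - S0) e)
          has_real_derivative w q * (m q - S0) * H q) (at e)"
        by (rule derivative_eq_intros deriv[OF q] refl)+ (simp add: H_def algebra_simps)
    qed
    moreover have "0 < (\<Sum>q=p..r. w q * (m q - S0) * H q)"
    proof (rule chebyshev_sum_pos[OF \<open>p < r\<close> w mean])
      show "m i - S0 < m j - S0" if "p \<le> i" "i < j" "j \<le> r" for i j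
        using strict_mono_interval[of p r m i j] m that by simp
      have "H (q - 1) < H q" if q: "p < q" "q \<le> r" for q
      proof -
        have mem: "q \<in> {p..r}" "q - 1 \<in> {p..r}" using q by auto
        have *: "H j = cut_mass a \<tau> S0 (m j - S0) e - (?a + m j * ?\<tau> - k j) * line_mass ?a ?\<tau> (m j)"
          if "j \<in> {p..r}" for j
          using \<kappa>[OF that] by (simp add: H_def algebra_simps)
        have "strip_mass ?a ?\<tau> (m (q - 1)) (m q) + (?a + m q * ?\<tau> - k q) * line_mass ?a ?\<tau> (m q)
            < (?a + m (q - 1) * ?\<tau> - k (q - 1)) * line_mass ?a ?\<tau> (m (q - 1))"
        proof (cases "k q \<le> ?a + m q * ?\<tau> \<or> ?a + m q * ?\<tau> \<le> 1")
          case True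
          then show ?thesis
            using v pos[OF mem(1)] pos[OF mem(2)] m[OF q] bottom[OF q] by (intro bottom_estimate) auto
        next
          case False
          then show ?thesis
            using v pos[OF mem(1)] pos[OF mem(2)] m[OF q] side[OF q] unit_cost[OF q]
            by (intro side_estimate) auto
        qed
        then show ?thesis
          using cut_mass_diff[of a \<tau> S0 "m (q - 1) - S0" e "m q - S0"]
          by (simp add: *[OF mem(1)] *[OF mem(2)] del: One_nat_def)
      qed
      then show "H i < H j" if "p \<le> i" "i < j" "j \<le> r" for i j
        using strict_mono_interval[of p r H i j] that by simp
    qed
    ultimately show "\<exists>y. (?Q has_real_derivative y) (at e) \<and> 0 < y" by blast
  next
    have "continuous_on {0..\<epsilon>} (cut_mass a \<tau> S0 (m q - S0))" for q
      by (rule lipschitz_on_continuous_on[of "K * \<bar>m q - S0\<bar>"], rule lipschitz_onI)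
        (use mass_lipschitz K_pos in \<open>auto simp: cut_mass_def dist_real_def\<close>)
    then show "continuous_on {0..\<epsilon>} ?Q" by (intro continuous_intros)
  qed
  then show ?thesis by simp
qed

end

section \<open>Thresholds and their lowest crossing\<close>

text \<open>Prices are indexed like the goods: \<open>v m\<close> is the price of the good \<open>y m\<close>.\<close>

locale menu =
  fixes F :: "real \<Rightarrow> real" and y :: "nat \<Rightarrow> real" and N :: nat
  assumes y_Suc: "\<And>i. i < N \<Longrightarrow> y i < y (Suc i)"
    and slope_pos: "\<And>i. i < N \<Longrightarrow> 0 < S F y i"
    and slope_Suc: "\<And>i. Suc i < N \<Longrightarrow> S F y i < S F y (Suc i)"
begin

definition gap :: "nat \<Rightarrow> real" where
  "gap i = y (Suc i) - y i"

definition val :: "(nat \<Rightarrow> real) \<Rightarrow> nat \<Rightarrow> real \<times> real \<Rightarrow> real" where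
  "val v m x = b F x (y m) - v m"

definition level :: "(nat \<Rightarrow> real) \<Rightarrow> nat \<Rightarrow> real" where
  "level v i = (v (Suc i) - v i) / gap i"

text \<open>The position in the row \<open>t\<close> of the line of indifference between the goods \<open>i\<close> and \<open>Suc i\<close>.\<close>

definition threshold :: "(nat \<Rightarrow> real) \<Rightarrow> nat \<Rightarrow> real \<Rightarrow> real" where
  "threshold v i t = level v i - S F y i * t"

lemma gap_pos: "i < N \<Longrightarrow> 0 < gap i"
  using y_Suc by (simp add: gap_def)

lemma slope_mono: "i < j \<Longrightarrow> j < N \<Longrightarrow> S F y i < S F y j"
proof (induction j)
  case (Suc j)
  then show ?case using slope_Suc[of j] by (cases "i = j") auto
qed simp

lemma y_mono: "i < j \<Longrightarrow> j \<le> N \<Longrightarrow> y i < y j"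
proof (induction j)
  case (Suc j)
  then show ?case using y_Suc[of j] by (cases "i = j") auto
qed simp

lemma b_eq: "b F x t = fst x * t + snd x * F t"
  by (simp add: b_def z_def inner_prod_def)

lemma val_Suc:
  assumes "i < N"
  shows "val v (Suc i) x - val v i x = gap i * (fst x - threshold v i (snd x))"
proof -
  have "gap i \<noteq> 0" using gap_pos[OF assms] by simp
  then have "gap i * S F y i = F (y (Suc i)) - F (y i)" "gap i * level v i = v (Suc i) - v i"
    by (simp_all add: S_def level_def gap_def)
  note eqs = this
  have "gap i * (fst x - threshold v i (snd x))
      = gap i * fst x - gap i * level v i + (gap i * S F y i) * snd x"
    by (simp add: threshold_def algebra_simps)
  also have "\<dots> = gap i * fst x - (v (Suc i) - v i) + (F (y (Suc i)) - F (y i)) * snd x"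
    by (simp only: eqs)
  finally show ?thesis by (simp add: val_def b_eq gap_def algebra_simps)
qed

lemma val_le_of_threshold_le:
  assumes "i \<le> j" "j \<le> N" "\<And>q. i \<le> q \<Longrightarrow> q < j \<Longrightarrow> threshold v q (snd x) \<le> fst x"
  shows "val v i x \<le> val v j x"
  using assms
proof (induction j)
  case (Suc j)
  show ?case
  proof (cases "i = Suc j")
    case False
    then have "val v i x \<le> val v j x" using Suc by auto
    moreover have "0 \<le> gap j * (fst x - threshold v j (snd x))"
      using Suc.prems False gap_pos[of j] by (intro mult_nonneg_nonneg) auto
    ultimately show ?thesis using val_Suc[of j v x] Suc.prems by simp
  qed simp
qed simp

lemma val_ge_of_threshold_ge:
  assumes "i \<le> j" "j \<le> N" "\<And>q. i \<le> q \<Longrightarrow> q < j \<Longrightarrow> fst x \<le> threshold v q (snd x)"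
  shows "val v j x \<le> val v i x"
  using assms
proof (induction j)
  case (Suc j)
  show ?case
  proof (cases "i = Suc j")
    case False
    then have "val v j x \<le> val v i x" using Suc by auto
    moreover have "gap j * (fst x - threshold v j (snd x)) \<le> 0"
      using Suc.prems False gap_pos[of j] by (intro mult_nonneg_nonpos) auto
    ultimately show ?thesis using val_Suc[of j v x] Suc.prems by simp
  qed simp
qed simp

definition crossing_row :: "(nat \<Rightarrow> real) \<Rightarrow> nat \<Rightarrow> real" where
  "crossing_row v i = (level v i - level v (i - 1)) / (S F y i - S F y (i - 1))"

text \<open>Some buyer of the square finds both neighbours of good \<open>i\<close> at least as good as \<open>i\<close> itself; this is
  how nestedness fails for consecutive thresholds.\<close>

definition crossing :: "(nat \<Rightarrow> real) \<Rightarrow> nat \<Rightarrow> bool" where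
  "crossing v i \<longleftrightarrow> 1 \<le> i \<and> i < N \<and>
    (\<exists>x\<in>X. threshold v i (snd x) \<le> fst x \<and> fst x \<le> threshold v (i - 1) (snd x))"

lemma threshold_diff:
  assumes "1 \<le> i" "i < N"
  shows "threshold v i t - threshold v (i - 1) t = (S F y i - S F y (i - 1)) * (crossing_row v i - t)"
  using slope_mono[of "i - 1" i] assms by (simp add: threshold_def crossing_row_def field_simps)

lemma threshold_le_iff:
  assumes "1 \<le> i" "i < N"
  shows "threshold v i t \<le> threshold v (i - 1) t \<longleftrightarrow> crossing_row v i \<le> t"
    and "threshold v (i - 1) t \<le> threshold v i t \<longleftrightarrow> t \<le> crossing_row v i"
    and "threshold v i t < threshold v (i - 1) t \<longleftrightarrow> crossing_row v i < t"
    and "threshold v i (crossing_row v i) = threshold v (i - 1) (crossing_row v i)"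
proof -
  have pos: "0 < S F y i - S F y (i - 1)" using slope_mono[of "i - 1" i] assms by simp
  note diff = threshold_diff[OF assms, of v t]
  have "threshold v i t \<le> threshold v (i - 1) t \<longleftrightarrow> (S F y i - S F y (i - 1)) * (crossing_row v i - t) \<le> 0"
    using diff by linarith
  then show "threshold v i t \<le> threshold v (i - 1) t \<longleftrightarrow> crossing_row v i \<le> t"
    using pos by (auto simp: mult_le_0_iff)
  have "threshold v (i - 1) t \<le> threshold v i t \<longleftrightarrow> 0 \<le> (S F y i - S F y (i - 1)) * (crossing_row v i - t)"
    using diff by linarith
  then show "threshold v (i - 1) t \<le> threshold v i t \<longleftrightarrow> t \<le> crossing_row v i"
    using pos by (auto simp: zero_le_mult_iff)
  have "threshold v i t < threshold v (i - 1) t \<longleftrightarrow> (S F y i - S F y (i - 1)) * (crossing_row v i - t) < 0"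
    using diff by linarith
  then show "threshold v i t < threshold v (i - 1) t \<longleftrightarrow> crossing_row v i < t"
    using pos by (auto simp: mult_less_0_iff)
  show "threshold v i (crossing_row v i) = threshold v (i - 1) (crossing_row v i)"
    using threshold_diff[OF assms, of v "crossing_row v i"] by simp
qed

lemma threshold_antimono: "i < N \<Longrightarrow> s \<le> t \<Longrightarrow> threshold v i t \<le> threshold v i s"
  using slope_pos[of i] by (simp add: threshold_def mult_left_mono)

text \<open>Good \<open>i\<close> is at least as good as both neighbours only in the cone below the intersection point of
  the two thresholds, and at most as good as both only in the cone above it. The touching point lies in the former
  and the point of the crossing in the latter, and this locates the intersection.\<close>

lemma crossing_point_in_square:
  assumes cross: "crossing v i"
    and touch: "\<exists>s\<in>{0..1}. \<exists>t\<in>{0..1}. val v (i - 1) (s, t) \<le> val v i (s, t) \<and> val v (Suc i) (s, t) \<le> val v i (s, t)"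
  shows "0 \<le> crossing_row v i" "crossing_row v i < 1"
    "0 < threshold v i (crossing_row v i)" "threshold v i (crossing_row v i) \<le> 1"
proof -
  let ?T = "crossing_row v i"
  have i: "1 \<le> i" "i < N" "i - 1 < N" using cross by (auto simp: crossing_def)
  obtain x1 x2 where x: "(x1, x2) \<in> X" "threshold v i x2 \<le> x1" "x1 \<le> threshold v (i - 1) x2"
    using cross by (auto simp: crossing_def)
  have T: "?T \<le> x2" using x threshold_le_iff(1)[OF i(1,2)] by (metis order_trans)
  then show "?T < 1" using x(1) by simp
  have "x1 \<le> threshold v (i - 1) ?T" using x(3) threshold_antimono[OF i(3) T] by (rule order_trans)
  then show "0 < threshold v i ?T" using x(1) threshold_le_iff(4)[OF i(1,2)] by (simp del: One_nat_def)
  obtain s t where st: "0 \<le> s" "s \<le> 1" "0 \<le> t" "t \<le> 1"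
    "val v (i - 1) (s, t) \<le> val v i (s, t)" "val v (Suc i) (s, t) \<le> val v i (s, t)"
    using touch by auto
  have "0 \<le> gap (i - 1) * (s - threshold v (i - 1) t)"
    using val_Suc[OF i(3), of v "(s, t)"] st i by simp
  then have 1: "threshold v (i - 1) t \<le> s" using gap_pos[OF i(3)] by (auto simp: zero_le_mult_iff)
  have "gap i * (s - threshold v i t) \<le> 0"
    using val_Suc[OF i(2), of v "(s, t)"] st i by simp
  then have "s \<le> threshold v i t" using gap_pos[OF i(2)] by (auto simp: mult_le_0_iff)
  with 1 have tT: "t \<le> ?T" using threshold_le_iff(2)[OF i(1,2)] by (metis order_trans)
  then show "0 \<le> ?T" using st by simp
  have "threshold v (i - 1) ?T \<le> s" using threshold_antimono[OF i(3) tT] 1 by (rule order_trans)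
  then show "threshold v i ?T \<le> 1" using st threshold_le_iff(4)[OF i(1,2)] by (simp del: One_nat_def)
qed

text \<open>At the lowest intersection point \<open>(a, \<tau>)\<close> of crossing thresholds, the sign of
  \<open>threshold v l \<tau> - a\<close> is nondecreasing in \<open>l\<close>: a decrease from \<open>l\<close> to \<open>Suc l\<close> would be a crossing
  whose intersection point lies strictly below row \<open>\<tau>\<close>.\<close>

lemma lowest_crossing:
  assumes cross: "crossing v i"
    and touch: "\<And>i. 1 \<le> i \<Longrightarrow> i < N \<Longrightarrow> \<exists>s\<in>{0..1}. \<exists>t\<in>{0..1}.
      val v (i - 1) (s, t) \<le> val v i (s, t) \<and> val v (Suc i) (s, t) \<le> val v i (s, t)"
  obtains p r a \<tau> where "p < r" "r < N" "0 < a" "a \<le> 1" "0 \<le> \<tau>" "\<tau> < 1"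
    "\<And>q. q \<in> {p..r} \<Longrightarrow> threshold v q \<tau> = a"
    "\<And>l. l < p \<Longrightarrow> threshold v l \<tau> < a" "\<And>l. r < l \<Longrightarrow> l < N \<Longrightarrow> a < threshold v l \<tau>"
proof -
  have "finite {i. crossing v i}" by (rule finite_subset[of _ "{..<N}"]) (auto simp: crossing_def)
  then obtain i0 where i0: "crossing v i0" and min: "\<And>i. crossing v i \<Longrightarrow> crossing_row v i0 \<le> crossing_row v i"
    using ex_is_arg_min_if_finite[of "{i. crossing v i}" "crossing_row v"] cross
    by (auto simp: is_arg_min_linorder)
  define \<tau> where "\<tau> = crossing_row v i0"
  define a where "a = threshold v i0 \<tau>"
  have range: "1 \<le> i0" "i0 < N" using i0 by (auto simp: crossing_def)
  have pt: "0 \<le> \<tau>" "\<tau> < 1" "0 < a" "a \<le> 1"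
    using crossing_point_in_square[OF i0 touch[OF range]] by (simp_all add: \<tau>_def a_def)
  have no_drop: False
    if l: "Suc l < N" and drop: "threshold v (Suc l) \<tau> \<le> a" "a \<le> threshold v l \<tau>"
      "threshold v (Suc l) \<tau> < threshold v l \<tau>" for l
  proof -
    have sp: "0 < S F y l" using slope_pos l by simp
    \<comment> \<open>a point slightly above the vertex, reached along the direction of threshold \<open>l\<close>, is in the square\<close>
    define \<eta> where "\<eta> = min ((1 - \<tau>) / 2) (a / (2 * S F y l))"
    have \<eta>: "0 < \<eta>" "\<tau> + \<eta> < 1" "S F y l * \<eta> \<le> a / 2"
    proof -
      show "0 < \<eta>" using pt sp by (simp add: \<eta>_def)
      have "\<eta> \<le> (1 - \<tau>) / 2" unfolding \<eta>_def by (rule min.cobounded1)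
      then show "\<tau> + \<eta> < 1" using pt by argo
      have "S F y l * \<eta> \<le> S F y l * (a / (2 * S F y l))" using sp by (intro mult_left_mono) (auto simp: \<eta>_def)
      then show "S F y l * \<eta> \<le> a / 2" using sp by simp
    qed
    have "0 < S F y l * \<eta>" using sp \<eta> by simp
    then have x: "(a - S F y l * \<eta>, \<tau> + \<eta>) \<in> X" using \<eta> pt by (simp del: zero_less_mult_iff)
    have "S F y l * \<eta> \<le> S F y (Suc l) * \<eta>" using slope_Suc[OF l] \<eta> by (intro mult_right_mono) auto
    then have "crossing v (Suc l)"
      unfolding crossing_def using l drop x
      by (intro conjI bexI[OF _ x]) (auto simp: threshold_def algebra_simps)
    from min[OF this] have "\<tau> \<le> crossing_row v (Suc l)" by (simp add: \<tau>_def)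
    moreover have "crossing_row v (Suc l) < \<tau>" using threshold_le_iff(3)[of "Suc l" v \<tau>] l drop(3) by simp
    ultimately show False by simp
  qed
  have up: "(a \<le> threshold v i \<tau> \<longrightarrow> a \<le> threshold v j \<tau>) \<and> (a < threshold v i \<tau> \<longrightarrow> a < threshold v j \<tau>)"
    if "i \<le> j" "j < N" for i j
    using that
  proof (induction j)
    case (Suc j)
    show ?case
    proof (cases "i = Suc j")
      case False
      then have IH: "(a \<le> threshold v i \<tau> \<longrightarrow> a \<le> threshold v j \<tau>) \<and> (a < threshold v i \<tau> \<longrightarrow> a < threshold v j \<tau>)"
        using Suc by auto
      show ?thesis using IH no_drop[of j] Suc.prems(2) by (smt (verit))
    qed simp
  qed simp
  define I where "I = {l. l < N \<and> threshold v l \<tau> = a}"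
  have fin: "finite I" by (simp add: I_def)
  have in_I: "i0 \<in> I" "i0 - 1 \<in> I"
    using range threshold_le_iff(4)[OF range, of v] by (auto simp: I_def a_def \<tau>_def)
  \<comment> \<open>the block consists of all thresholds through the vertex\<close>
  define p where "p = Min I"
  define r where "r = Max I"
  have pI: "p \<in> I" "r \<in> I" using fin in_I by (auto simp: p_def r_def intro!: Min_in Max_in)
  have "p \<le> i0 - 1" "i0 \<le> r" using fin in_I by (auto simp: p_def r_def)
  show thesis
  proof (rule that[of p r a \<tau>])
    show "p < r" using \<open>p \<le> i0 - 1\<close> \<open>i0 \<le> r\<close> range by simp
    show "r < N" using pI by (simp add: I_def)
    show "threshold v q \<tau> = a" if "q \<in> {p..r}" for q
      using up[of p q] up[of q r] pI that by (auto simp: I_def)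
    show "threshold v l \<tau> < a" if "l < p" for l
    proof -
      have "l < N" using that pI by (simp add: I_def)
      moreover have "l \<notin> I" using that fin by (metis Min_le not_le p_def)
      ultimately show ?thesis using up[of l p] pI that by (force simp: I_def)
    qed
    show "a < threshold v l \<tau>" if "r < l" "l < N" for l
    proof -
      have "l \<notin> I" using that fin by (metis Max_ge not_le r_def)
      then show ?thesis using up[of r l] pI that by (force simp: I_def)
    qed
  qed (use pt in auto)
qed

end

section \<open>Choices after moving the vertex\<close>

definition (in menu) best :: "(nat \<Rightarrow> real) \<Rightarrow> nat \<Rightarrow> real \<times> real \<Rightarrow> bool" where
  "best v m x \<longleftrightarrow> m \<le> N \<and> (\<forall>n\<le>N. n \<noteq> m \<longrightarrow> val v n x < val v m x)"

text \<open>The slope of the line of indifference between the goods \<open>p\<close> and \<open>Suc r\<close>.\<close>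

definition (in menu) chord :: "nat \<Rightarrow> nat \<Rightarrow> real" where
  "chord p r = (F (y (Suc r)) - F (y p)) / (y (Suc r) - y p)"

lemma (in menu) gap_slope: "i < N \<Longrightarrow> gap i * S F y i = F (y (Suc i)) - F (y i)"
  and gap_level: "i < N \<Longrightarrow> gap i * level v i = v (Suc i) - v i"
  using y_Suc[of i] by (simp_all add: gap_def S_def level_def)

lemma (in menu) level_unique:
  "i < N \<Longrightarrow> v (Suc i) - v i = gap i * k \<Longrightarrow> level v i = k"
  using gap_pos[of i] by (simp add: level_def)

text \<open>The thresholds of the block \<open>p, ..., r\<close> pass through \<open>(a, \<tau>)\<close>, and \<open>\<epsilon>\<close> is so small that they do not
  meet any other threshold when the vertex is moved by at most \<open>\<epsilon>\<close>.\<close>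

locale vertex = menu +
  fixes v :: "nat \<Rightarrow> real" and p r :: nat and a \<tau> \<epsilon> :: real
  assumes p_less_r: "p < r" and r_less_N: "r < N"
    and through: "\<And>q. q \<in> {p..r} \<Longrightarrow> threshold v q \<tau> = a"
    and \<epsilon>_pos: "0 < \<epsilon>"
    and left: "\<And>l. l < p \<Longrightarrow> \<epsilon> * chord p r < a - threshold v l \<tau>"
    and right: "\<And>l. r < l \<Longrightarrow> l < N \<Longrightarrow> \<epsilon> * S F y l < threshold v l \<tau> - a"
begin

abbreviation S0 :: real where "S0 \<equiv> chord p r"

text \<open>The rate of the price change that moves the vertex: the distance of \<open>F\<close> below its chord from
  \<open>p\<close> to \<open>Suc r\<close>, taken negative. It vanishes at both ends, hence the prices outside the block are
  unchanged.\<close>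

definition shift :: "nat \<Rightarrow> real" where
  "shift m = (if p \<le> m \<and> m \<le> Suc r then F (y m) - F (y p) - S0 * (y m - y p) else 0)"

definition moved :: "real \<Rightarrow> nat \<Rightarrow> real" where
  "moved e m = v m + e * shift m"

lemma shift_ends: "shift p = 0" "shift (Suc r) = 0"
proof -
  have "y (Suc r) - y p \<noteq> 0" using y_mono[of p "Suc r"] p_less_r r_less_N by simp
  then show "shift p = 0" "shift (Suc r) = 0" by (simp_all add: shift_def chord_def)
qed

lemma shift_outside: "m \<le> p \<or> r < m \<Longrightarrow> shift m = 0"
  using shift_ends by (cases "m = p \<or> m = Suc r") (auto simp: shift_def)

lemma shift_Suc: "q \<in> {p..r} \<Longrightarrow> shift (Suc q) - shift q = gap q * (S F y q - S0)"
  using gap_slope[of q] r_less_N by (simp add: shift_def gap_def algebra_simps)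

lemma sum_tilt: "(\<Sum>q=p..r. gap q * (S F y q - S0)) = 0"
proof -
  have "(\<Sum>q=p..r. gap q * (S F y q - S0)) = (\<Sum>q=p..r. shift (Suc q) - shift q)"
    by (intro sum.cong) (auto simp: shift_Suc)
  also have "\<dots> = 0" using p_less_r by (subst sum_Suc_diff) (auto simp: shift_ends)
  finally show ?thesis .
qed

lemma tilt_mono: "p \<le> i \<Longrightarrow> i < j \<Longrightarrow> j \<le> r \<Longrightarrow> S F y i - S0 < S F y j - S0"
  using slope_mono[of i j] r_less_N by simp

text \<open>The increasing sequence \<open>S F y q - S0\<close> has weighted mean zero, so it changes sign on the block.\<close>

lemma tilt_bounds: "S F y p < S0" "S0 < S F y r"
proof -
  have neg: False if nonneg: "\<And>q. q \<in> {p..r} \<Longrightarrow> 0 \<le> s * (S F y q - S0)" "q \<in> {p..r}" "0 < s * (S F y q - S0)" for s q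
  proof -
    have "0 < (\<Sum>q=p..r. gap q * (s * (S F y q - S0)))"
    proof (rule sum_pos2)
      show "0 < gap q * (s * (S F y q - S0))" 
        by (rule mult_pos_pos[OF gap_pos]) (use that r_less_N in auto)
      show "0 \<le> gap i * (s * (S F y i - S0))" if "i \<in> {p..r}" for i

        by (rule mult_nonneg_nonneg[OF less_imp_le[OF gap_pos]]) (use that nonneg r_less_N in auto)
    qed (use that in auto)
    also have "\<dots> = s * (\<Sum>q=p..r. gap q * (S F y q - S0))"
      by (simp add: sum_distrib_left mult.left_commute)
    finally show False by (simp add: sum_tilt)
  qed
  have le: "S F y p \<le> S F y q" "S F y q \<le> S F y r" if "q \<in> {p..r}" for q
    using tilt_mono[of p q] tilt_mono[of q r] that by (cases "q = p"; cases "q = r"; auto)+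
  show "S F y p < S0"
    using neg[of 1 r] le tilt_mono[of p r] p_less_r by (smt (verit) atLeastAtMost_iff less_imp_le order_refl mult_1)
  show "S0 < S F y r"
    using neg[of "-1" p] le tilt_mono[of p r] p_less_r by (smt (verit) atLeastAtMost_iff less_imp_le order_refl)
qed

lemma chord_pos: "0 < S0"
  using slope_pos[of p] tilt_bounds p_less_r r_less_N by simp

lemma shift_nonpos: "shift m \<le> 0"
proof (cases "p < m \<and> m \<le> r")
  case True
  have sum: "shift n - shift i = (\<Sum>q=i..<n. gap q * (S F y q - S0))"
    if "p \<le> i" "i \<le> n" "n \<le> Suc r" for i n
  proof -
    have "(\<Sum>q=i..<n. gap q * (S F y q - S0)) = (\<Sum>q=i..<n. shift (Suc q) - shift q)"
      using that by (intro sum.cong) (auto simp: shift_Suc)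
    then show ?thesis using that by (simp add: sum_Suc_diff')
  qed
  show ?thesis
  proof (cases "S F y m \<le> S0")
    case le: True
    have "shift m - shift p \<le> 0" unfolding sum[of p m, OF order_refl less_imp_le[OF conjunct1[OF True]] le_SucI[OF conjunct2[OF True]]]
    proof (rule sum_nonpos)
      fix q assume q: "q \<in> {p..<m}"
      then have "S F y q - S0 \<le> 0" using tilt_mono[of q m] le True by auto
      then show "gap q * (S F y q - S0) \<le> 0" 
        using gap_pos[of q] q True r_less_N by (intro mult_nonneg_nonpos) auto
    qed
    then show ?thesis by (simp add: shift_ends)
  next
    case False
    have "0 \<le> (\<Sum>q=m..<Suc r. gap q * (S F y q - S0))"
    proof (rule sum_nonneg)
      fix q assume q: "q \<in> {m..<Suc r}"
      then have "0 \<le> S F y q - S0" using tilt_mono[of m q] False True by (cases "q = m") auto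
      then show "0 \<le> gap q * (S F y q - S0)" using gap_pos[of q] q r_less_N by simp
    qed
    moreover have "shift (Suc r) - shift m = (\<Sum>q=m..<Suc r. gap q * (S F y q - S0))"
      using True by (intro sum) auto
    ultimately have "0 \<le> shift (Suc r) - shift m" by (simp only:)
    then show ?thesis by (simp add: shift_ends)
  qed
qed (use shift_outside in force)

lemma v_block:
  assumes "p \<le> m" "m \<le> Suc r"
  shows "v m = v p + a * (y m - y p) + \<tau> * (F (y m) - F (y p))"
  using assms
proof (induction m)
  case (Suc q)
  show ?case
  proof (cases "p = Suc q")
    case False
    then have q: "q \<in> {p..r}" "q < N" using Suc.prems r_less_N by auto
    have "level v q = a + S F y q * \<tau>" using through[OF q(1)] by (simp add: threshold_def)
    then have "v (Suc q) - v q = gap q * a + (gap q * S F y q) * \<tau>"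
      using gap_level[OF q(2), of v] by (simp add: algebra_simps)
    also have "\<dots> = a * (y (Suc q) - y q) + \<tau> * (F (y (Suc q)) - F (y q))"
      unfolding gap_slope[OF q(2)] by (simp add: gap_def algebra_simps)
    finally show ?thesis using Suc.IH q by (simp add: algebra_simps)
  qed simp
qed simp

text \<open>The first summand vanishes on the line that separates \<open>p\<close> from \<open>Suc r\<close>. As \<open>shift\<close> is nonpositive on
  the block, the second one makes the inner goods attractive below the vertex and unattractive
  above it.\<close>

lemma val_block:
  assumes "p \<le> m" "m \<le> Suc r"
  shows "val (moved e) m x - val (moved e) p x
    = (y m - y p) * (fst x - (a + S0 * (\<tau> - snd x))) - (\<tau> + e - snd x) * shift m"
proof -
  have "F (y m) - F (y p) = shift m + S0 * (y m - y p)" using assms by (simp add: shift_def)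
  then have F: "F (y m) = F (y p) + shift m + S0 * (y m - y p)" by simp
  show ?thesis
    unfolding val_def b_eq moved_def v_block[OF assms] F by (simp add: shift_ends algebra_simps)
qed

lemma level_block: "q \<in> {p..r} \<Longrightarrow> level v q = a + S F y q * \<tau>"
  using through[of q] by (simp add: threshold_def)

lemma level_moved:
  assumes "q \<in> {p..r}"
  shows "level (moved e) q = level v q + e * (S F y q - S0)"
proof (rule level_unique)
  show q: "q < N" using assms r_less_N by simp
  have "moved e (Suc q) - moved e q = (v (Suc q) - v q) + e * (shift (Suc q) - shift q)"
    by (simp add: moved_def algebra_simps)
  then show "moved e (Suc q) - moved e q = gap q * (level v q + e * (S F y q - S0))"
    unfolding shift_Suc[OF assms] gap_level[OF q, of v, symmetric] by (simp add: algebra_simps)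
qed

abbreviation cut_at :: "nat \<Rightarrow> real \<Rightarrow> real \<Rightarrow> real" where
  "cut_at q \<equiv> cut a \<tau> S0 (S F y q - S0)"

lemma threshold_moved:
  assumes "q \<in> {p..r}" "t \<le> \<tau> + e"
  shows "threshold (moved e) q t = cut_at q e t"
  unfolding threshold_def level_moved[OF assms(1)] level_block[OF assms(1)] cut_below[OF assms(2)]
  by (simp add: algebra_simps)

lemma threshold_moved_outside:
  assumes "l < N" "l < p \<or> r < l"
  shows "threshold (moved e) l t = threshold v l t"
proof -
  have "shift l = 0" "shift (Suc l) = 0" using assms shift_outside by auto
  then show ?thesis by (simp add: threshold_def level_def moved_def)
qed

lemma cut_at_mono:
  assumes "p \<le> i" "i \<le> j" "j \<le> r"
  shows "cut_at i e t \<le> cut_at j e t"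
  using assms tilt_mono[of i j] by (cases "i = j") (auto simp: cut_def intro!: mult_right_mono)

text \<open>Going down from the vertex, the distance to a smaller threshold only grows since the slopes
  increase with the index. Moving the vertex, or going up to row \<open>\<tau> + \<epsilon>\<close>, reduces it by at most
  \<open>\<epsilon> * S0\<close>.\<close>

lemma cut_at_right_of:
  assumes l: "l < p" and q: "q \<in> {p..r}" and e: "0 \<le> e" "e \<le> \<epsilon>" and t: "t \<le> \<tau> + \<epsilon>"
  shows "threshold v l t < cut_at q e t"
proof -
  have Sl: "0 < S F y l" "S F y l < S F y q" "S F y l < S0"
    using slope_pos[of l] slope_mono[of l q] slope_mono[of l p] l q r_less_N p_less_r tilt_bounds by auto
  have thr: "threshold v l t = threshold v l \<tau> + S F y l * (\<tau> - t)" by (simp add: threshold_def algebra_simps)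
  show ?thesis
  proof (cases "t \<le> \<tau> + e")
    case True
    have "cut_at q e t - threshold v l t
        = (a - threshold v l \<tau>) - S0 * e + S F y l * e + (S F y q - S F y l) * (\<tau> + e - t)"
      unfolding cut_below[OF True] thr by (simp add: algebra_simps)
    moreover have "0 \<le> S F y l * e" "0 \<le> (S F y q - S F y l) * (\<tau> + e - t)" "S0 * e \<le> \<epsilon> * S0"
      using Sl e True chord_pos by (auto intro: mult_right_mono simp: mult.commute)
    ultimately show ?thesis using left[OF l] by simp
  next
    case False
    then have "cut_at q e t = a + S0 * (\<tau> - t)" by (intro cut_above) simp
    then have "cut_at q e t - threshold v l t = (a - threshold v l \<tau>) - (S0 - S F y l) * (t - \<tau>)"
      unfolding thr by (simp add: algebra_simps)
    moreover have "(S0 - S F y l) * (t - \<tau>) \<le> S0 * \<epsilon>"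
      using Sl t chord_pos e False by (intro mult_mono) auto
    ultimately show ?thesis using left[OF l] by (simp add: mult.commute)
  qed
qed

text \<open>As before, but here the distance shrinks by at most \<open>\<epsilon> * S F y l\<close>.\<close>

lemma cut_at_left_of:
  assumes l: "r < l" "l < N" and q: "q \<in> {p..r}" and e: "0 \<le> e" "e \<le> \<epsilon>" and t: "t \<le> \<tau> + \<epsilon>"
  shows "cut_at q e t < threshold v l t"
proof -
  have Sl: "0 < S F y l" "S F y q < S F y l" "S0 < S F y l"
    using slope_pos[of l] slope_mono[of q l] slope_mono[of r l] l q r_less_N p_less_r tilt_bounds by auto
  have thr: "threshold v l t = threshold v l \<tau> + S F y l * (\<tau> - t)" by (simp add: threshold_def algebra_simps)
  show ?thesis
  proof (cases "t \<le> \<tau> + e")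
    case True
    have "threshold v l t - cut_at q e t
        = (threshold v l \<tau> - a) - S F y l * e + S0 * e + (S F y l - S F y q) * (\<tau> + e - t)"
      unfolding cut_below[OF True] thr by (simp add: algebra_simps)
    moreover have "0 \<le> S0 * e" "0 \<le> (S F y l - S F y q) * (\<tau> + e - t)" "S F y l * e \<le> \<epsilon> * S F y l"
      using Sl e True chord_pos by (auto intro: mult_right_mono simp: mult.commute)
    ultimately show ?thesis using right[OF l] by simp
  next
    case False
    then have "cut_at q e t = a + S0 * (\<tau> - t)" by (intro cut_above) simp
    then have "threshold v l t - cut_at q e t = (threshold v l \<tau> - a) - (S F y l - S0) * (t - \<tau>)"
      unfolding thr by (simp add: algebra_simps)
    moreover have "(S F y l - S0) * (t - \<tau>) \<le> S F y l * \<epsilon>"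
      using Sl t chord_pos e False by (intro mult_mono) auto
    ultimately show ?thesis using right[OF l] by (simp add: mult.commute)
  qed
qed

text \<open>Below the moved vertex the thresholds are ordered from the good \<open>p\<close> onwards, so that the choice can
  be read off from the thresholds. Above it nobody chooses an inner good and all cuts equal
  the line between \<open>p\<close> and \<open>Suc r\<close>.\<close>

lemma best_iff_cut:
  assumes M: "best (moved e) M x" and e: "0 \<le> e" "e \<le> \<epsilon>" and t: "snd x \<le> \<tau> + \<epsilon>" and l: "l \<in> {p..r}"
  shows "l < M \<longleftrightarrow> cut_at l e (snd x) < fst x"
proof (rule ccontr)
  assume wrong: "\<not> ?thesis"
  have better: "val (moved e) n x < val (moved e) M x" if "n \<le> N" "n \<noteq> M" for n
    using M that by (auto simp: best_def)
  have MN: "M \<le> N" using M by (simp add: best_def)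
  consider (too_high) "l < M" "fst x \<le> cut_at l e (snd x)" | (too_low) "M \<le> l" "cut_at l e (snd x) < fst x"
    using wrong by fastforce
  then show False
  proof cases
    case too_high
    have right_out: "fst x \<le> threshold (moved e) q (snd x)" if "r < q" "q < N" for q
      using cut_at_left_of[OF that l e t] threshold_moved_outside[of q e "snd x"] that too_high by simp
    show False
    proof (cases "snd x \<le> \<tau> + e")
      case True
      have "val (moved e) M x \<le> val (moved e) l x"
      proof (rule val_ge_of_threshold_ge)
        fix q assume q: "l \<le> q" "q < M"
        show "fst x \<le> threshold (moved e) q (snd x)"
        proof (cases "q \<le> r")
          case qr: True
          then have "cut_at l e (snd x) \<le> cut_at q e (snd x)" using q l by (intro cut_at_mono) auto
          then show ?thesis using threshold_moved[of q "snd x" e] True qr q l too_high by simp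
        qed (use right_out q MN in auto)
      qed (use too_high MN in auto)
      then show False using better[of l] too_high MN l r_less_N by simp
    next
      case False
      have cut: "cut_at l e (snd x) = a + S0 * (\<tau> - snd x)" using False by (intro cut_above) simp
      show False
      proof (cases "M \<le> Suc r")
        case True
        have "(y M - y p) * (fst x - (a + S0 * (\<tau> - snd x))) \<le> 0"
          using y_mono[of p M] too_high l MN cut by (intro mult_nonneg_nonpos) auto
        moreover have "0 \<le> (\<tau> + e - snd x) * shift M"
          using False shift_nonpos by (intro mult_nonpos_nonpos) auto
        ultimately have "val (moved e) M x \<le> val (moved e) p x"
          using val_block[of M e x] True too_high l by simp
        then show False using better[of p] too_high l p_less_r r_less_N by simp
      next
        case M: False
        have "val (moved e) M x \<le> val (moved e) (Suc r) x"
          using M MN by (intro val_ge_of_threshold_ge right_out) auto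
        then show False using better[of "Suc r"] M r_less_N by simp
      qed
    qed
  next
    case too_low
    have left_out: "threshold (moved e) q (snd x) \<le> fst x" if "q < p" for q
      using cut_at_right_of[OF that l e t] threshold_moved_outside[of q e "snd x"] that too_low p_less_r r_less_N
      by simp
    show False
    proof (cases "snd x \<le> \<tau> + e")
      case True
      have "val (moved e) M x \<le> val (moved e) (Suc l) x"
      proof (rule val_le_of_threshold_le)
        fix q assume q: "M \<le> q" "q < Suc l"
        show "threshold (moved e) q (snd x) \<le> fst x"
        proof (cases "p \<le> q")
          case pq: True
          then have "cut_at q e (snd x) \<le> cut_at l e (snd x)" using q l by (intro cut_at_mono) auto
          then show ?thesis using threshold_moved[of q "snd x" e] True pq q l too_low by simp
        qed (use left_out in auto)
      qed (use too_low l r_less_N in auto)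
      then show False using better[of "Suc l"] too_low l r_less_N by simp
    next
      case False
      have cut: "cut_at l e (snd x) = a + S0 * (\<tau> - snd x)" using False by (intro cut_above) simp
      show False
      proof (cases "p \<le> M")
        case True
        have "0 \<le> (y (Suc r) - y M) * (fst x - (a + S0 * (\<tau> - snd x)))"
          using y_mono[of M "Suc r"] too_low l r_less_N cut by (intro mult_nonneg_nonneg) auto
        moreover have "0 \<le> (\<tau> + e - snd x) * shift M"
          using False shift_nonpos by (intro mult_nonpos_nonpos) auto
        moreover have "val (moved e) (Suc r) x - val (moved e) M x
            = (y (Suc r) - y M) * (fst x - (a + S0 * (\<tau> - snd x))) + (\<tau> + e - snd x) * shift M"
          using val_block[of M e x] val_block[of "Suc r" e x] True too_low l p_less_r
          by (simp add: shift_ends algebra_simps)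
        ultimately have "val (moved e) M x \<le> val (moved e) (Suc r) x" by simp
        then show False using better[of "Suc r"] too_low l r_less_N by simp
      next
        case M: False
        have "val (moved e) M x \<le> val (moved e) p x"
          using M p_less_r r_less_N by (intro val_le_of_threshold_le left_out) auto
        then show False using better[of p] M p_less_r r_less_N by simp
      qed
    qed
  qed
qed

text \<open>What a buyer contributes to the profit by upgrading inside the block. Below the moved vertex the
  upgrades end at some good of the block; above it all or none of them are taken, as the cuts coincide.\<close>

definition block_profit :: "(nat \<Rightarrow> real) \<Rightarrow> real \<Rightarrow> real \<times> real \<Rightarrow> real" where
  "block_profit k e x = (\<Sum>q=p..r. gap q * (level v q + e * (S F y q - S0) - k q)
      * (if cut_at q e (snd x) < fst x then 1 else 0))"

text \<open>The markup on the whole upgrade from \<open>p\<close> to \<open>Suc r\<close> does not depend on \<open>e\<close>, because the prices of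
  these two goods do not change.\<close>

lemma sum_level_const:
  "(\<Sum>q=p..r. gap q * (level v q + e * (S F y q - S0) - k q)) = (\<Sum>q=p..r. gap q * (level v q - k q))"
proof -
  have "(\<Sum>q=p..r. gap q * (level v q + e * (S F y q - S0) - k q))
      = (\<Sum>q=p..r. gap q * (level v q - k q) + e * (gap q * (S F y q - S0)))"
    by (intro sum.cong) (auto simp: algebra_simps)
  also have "\<dots> = (\<Sum>q=p..r. gap q * (level v q - k q)) + e * (\<Sum>q=p..r. gap q * (S F y q - S0))"
    by (simp add: sum.distrib sum_distrib_left)
  finally show ?thesis by (simp add: sum_tilt)
qed

lemma block_profit_inside:
  assumes "best (moved e) M x" "0 \<le> e" "e \<le> \<epsilon>" "snd x \<le> \<tau> + \<epsilon>" "p \<le> M" "M \<le> Suc r"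
    and k: "\<And>q. q \<in> {p..r} \<Longrightarrow> gap q * k q = cost (Suc q) - cost q"
  shows "moved e M - cost M - block_profit k e x = v p - cost p"
proof -
  have "block_profit k e x = (\<Sum>q=p..r. gap q * (level v q + e * (S F y q - S0) - k q) * (if q < M then 1 else 0))"
    unfolding block_profit_def using best_iff_cut[OF assms(1-4)] by (intro sum.cong) auto
  also have "\<dots> = (\<Sum>q\<in>{p..<M}. gap q * (level v q + e * (S F y q - S0) - k q))"
    using assms(5,6) by (intro sum.mono_neutral_cong_right) auto
  also have "\<dots> = (\<Sum>q\<in>{p..<M}. (moved e (Suc q) - cost (Suc q)) - (moved e q - cost q))"
  proof (rule sum.cong)
    fix q assume "q \<in> {p..<M}"
    then have q: "q \<in> {p..r}" "q < N" using assms(6) r_less_N by auto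
    have "gap q * (level v q + e * (S F y q - S0) - k q) = gap q * level (moved e) q - gap q * k q"
      by (simp add: level_moved[OF q(1)] algebra_simps)
    then show "gap q * (level v q + e * (S F y q - S0) - k q) = (moved e (Suc q) - cost (Suc q)) - (moved e q - cost q)"
      by (simp add: gap_level[OF q(2)] k[OF q(1)])
  qed simp
  also have "\<dots> = (moved e M - cost M) - (moved e p - cost p)"
    using sum_Suc_diff'[of p M "\<lambda>q. moved e q - cost q"] assms(5) by simp
  finally show ?thesis by (simp add: moved_def shift_ends)
qed

text \<open>Moving the vertex changes the margin earned from a buyer only through the upgrades inside the
  block. A buyer who chooses outside the block before or after the move chooses the same good in
  both cases, because the values of those goods are unchanged and the cuts stay away from the
  other thresholds. Above row \<open>\<tau> + \<epsilon>\<close> nobody is affected at all.\<close>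

lemma profit_change_pointwise:
  assumes M0: "best (moved 0) M0 x" and M1: "best (moved \<epsilon>) M1 x"
    and k: "\<And>q. q \<in> {p..r} \<Longrightarrow> gap q * k q = cost (Suc q) - cost q"
  shows "moved 0 M0 - cost M0 - block_profit k 0 x = moved \<epsilon> M1 - cost M1 - block_profit k \<epsilon> x"
proof -
  have same: "M0 = M1" if "M0 \<le> p \<or> r < M0" "M1 \<le> p \<or> r < M1"
  proof (rule ccontr)
    assume ne: "M0 \<noteq> M1"
    have "shift M0 = 0" "shift M1 = 0" using that shift_outside by auto
    then have "val (moved 0) M0 x = val (moved \<epsilon>) M0 x" "val (moved 0) M1 x = val (moved \<epsilon>) M1 x"
      by (simp_all add: val_def moved_def)
    moreover have "val (moved 0) M1 x < val (moved 0) M0 x" "val (moved \<epsilon>) M0 x < val (moved \<epsilon>) M1 x"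
      using M0 M1 ne by (auto simp: best_def)
    ultimately show False by simp
  qed
  have ends: "moved 0 M0 - cost M0 - block_profit k 0 x = moved \<epsilon> M1 - cost M1 - block_profit k \<epsilon> x"
    if "M0 = M1" "M1 \<le> p \<or> r < M1" 
      and const: "\<And>q e. q \<in> {p..r} \<Longrightarrow> e \<in> {0, \<epsilon>} \<Longrightarrow> cut_at q e (snd x) < fst x \<longleftrightarrow> B" for B
  proof -
    have "block_profit k e x = (if B then \<Sum>q=p..r. gap q * (level v q - k q) else 0)" if "e \<in> {0, \<epsilon>}" for e
      unfolding block_profit_def sum_level_const[of e k, symmetric] using const[OF _ that]
      by (auto intro!: sum.cong sum.neutral)
    then have "block_profit k 0 x = block_profit k \<epsilon> x" by simp
    moreover have "shift M1 = 0" using that(2) shift_outside by auto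
    ultimately show ?thesis using that(1) by (simp add: moved_def)
  qed
  show ?thesis
  proof (cases "snd x \<le> \<tau> + \<epsilon>")
    case True
    have e: "0 \<le> (0::real)" "0 \<le> \<epsilon>" "\<epsilon> \<le> \<epsilon>" using \<epsilon>_pos by auto
    note cut0 = best_iff_cut[OF M0 e(1,2) True] and cut1 = best_iff_cut[OF M1 e(2,3) True]
    have N: "M0 \<le> N" "M1 \<le> N" using M0 M1 by (auto simp: best_def)
    have low: "\<not> cut_at q e' (snd x) < fst x"
      if M: "best (moved e) M x" "M < p" "0 \<le> e'" "e' \<le> \<epsilon>" "q \<in> {p..r}" for e M q e'
    proof -
      have "\<not> val (moved e) M x \<le> val (moved e) p x" 
        using M p_less_r r_less_N by (auto simp: best_def not_le)
      then obtain l where l: "M \<le> l" "l < p" "fst x < threshold (moved e) l (snd x)"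
        using val_le_of_threshold_le[where i = M and j = p and v = "moved e" and x = x] M p_less_r r_less_N by fastforce
      then have "fst x < threshold v l (snd x)"
        using threshold_moved_outside[of l e "snd x"] p_less_r r_less_N by simp
      then show ?thesis using cut_at_right_of[OF l(2) M(5) M(3,4) True] by simp
    qed
    have high: "cut_at q e' (snd x) < fst x"
      if M: "best (moved e) M x" "Suc r < M" "0 \<le> e'" "e' \<le> \<epsilon>" "q \<in> {p..r}" for e M q e'
    proof -
      have MN: "M \<le> N" using M by (simp add: best_def)
      have "\<not> val (moved e) M x \<le> val (moved e) (Suc r) x" 
        using M p_less_r r_less_N by (auto simp: best_def not_le)
      then obtain l where l: "Suc r \<le> l" "l < M" "threshold (moved e) l (snd x) < fst x"
        using val_ge_of_threshold_ge[where i = "Suc r" and j = M and v = "moved e" and x = x] M MN by fastforce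
      then have "threshold v l (snd x) < fst x"
        using threshold_moved_outside[of l e "snd x"] MN by simp
      then show ?thesis using cut_at_left_of[of l q e' "snd x"] M l True MN by simp
    qed
    consider "M0 < p \<or> M1 < p" | "Suc r < M0 \<or> Suc r < M1"
      | "p \<le> M0" "M0 \<le> Suc r" "p \<le> M1" "M1 \<le> Suc r" by linarith
    then show ?thesis
    proof cases
      case 1
      have no: "\<not> cut_at q e (snd x) < fst x" if "q \<in> {p..r}" "e \<in> {0, \<epsilon>}" for q e
        using 1 low[OF M0 _ _ _ that(1)] low[OF M1 _ _ _ that(1)] that(2) \<epsilon>_pos by auto
      then have "M0 \<le> p" "M1 \<le> p" using cut0[of p] cut1[of p] p_less_r by auto
      then show ?thesis using same no by (intro ends[of False]) auto
    next
      case 2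
      have yes: "cut_at q e (snd x) < fst x" if "q \<in> {p..r}" "e \<in> {0, \<epsilon>}" for q e
        using 2 high[OF M0 _ _ _ that(1)] high[OF M1 _ _ _ that(1)] that(2) \<epsilon>_pos by auto
      then have "r < M0" "r < M1" using cut0[of r] cut1[of r] p_less_r by auto
      then show ?thesis using same yes by (intro ends[of True]) auto
    next
      case 3
      show ?thesis
        using block_profit_inside[OF M0 e(1,2) True 3(1,2) k] block_profit_inside[OF M1 e(2,3) True 3(3,4) k]
        by simp
    qed
  next
    case False
    have out: "M \<le> p \<or> r < M" if M: "best (moved e) M x" "e \<in> {0, \<epsilon>}" for e M
    proof (rule ccontr)
      assume inner: "\<not> ?thesis"
      let ?h = "a + S0 * (\<tau> - snd x)"
      have neg: "\<tau> + e - snd x \<le> 0" using False M(2) \<epsilon>_pos by auto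
      have yM: "0 < y M - y p" "0 < y (Suc r) - y M" using y_mono[of p M] y_mono[of M "Suc r"] inner r_less_N by auto
      have better: "val (moved e) n x < val (moved e) M x" if "n \<in> {p, Suc r}" for n
        using M inner that p_less_r r_less_N by (auto simp: best_def)
      have nn: "0 \<le> (\<tau> + e - snd x) * shift M" using neg shift_nonpos by (intro mult_nonpos_nonpos)
      have "(y M - y p) * (fst x - ?h) - (\<tau> + e - snd x) * shift M = val (moved e) M x - val (moved e) p x"
        using inner by (subst val_block) auto
      then have "0 < (y M - y p) * (fst x - ?h)" using better[of p] nn by simp
      then have "0 < fst x - ?h" using yM(1) zero_less_mult_pos by blast
      then have "0 < (y (Suc r) - y M) * (fst x - ?h)" using yM(2) by simp
      moreover have "val (moved e) (Suc r) x - val (moved e) M x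
          = (y (Suc r) - y M) * (fst x - ?h) + (\<tau> + e - snd x) * shift M"
        using val_block[of M e x] val_block[of "Suc r" e x] inner p_less_r
        by (simp add: shift_ends algebra_simps)
      ultimately show False using better[of "Suc r"] nn by simp
    qed
    have "M0 \<le> p \<or> r < M0" "M1 \<le> p \<or> r < M1" using out[OF M0] out[OF M1] by auto
    then show ?thesis
      using same False \<epsilon>_pos by (intro ends[of "a + S0 * (\<tau> - snd x) < fst x"]) (auto simp: cut_above)
  qed
qed

end

section \<open>Profit as an integral of margins\<close>

lemma X_lebesgue: "X \<in> sets lebesgue"
  by (simp add: sets_completionI)

text \<open>The integrand in the definition of the profit is unspecified on a null set; it is measurable because
  Lebesgue measure is complete.\<close>

lemma integral_lebesgue_on_X_cong_AE:
  fixes g h :: "real \<times> real \<Rightarrow> real"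
  assumes g: "g \<in> borel_measurable (lebesgue_on X)" and AE: "AE x in lebesgue_on X. h x = g x"
  shows "integral\<^sup>L (lebesgue_on X) h = integral\<^sup>L (lebesgue_on X) g"
proof -
  let ?g = "\<lambda>x. indicat_real X x *\<^sub>R g x" and ?h = "\<lambda>x. indicat_real X x *\<^sub>R h x"
  have X: "X \<inter> space lebesgue \<in> sets lebesgue" using X_lebesgue by simp
  have g': "?g \<in> borel_measurable lebesgue" using g X borel_measurable_restrict_space_iff[OF X, of g] by simp
  have AE': "AE x in lebesgue. ?g x = ?h x"
    using AE unfolding AE_restrict_space_iff[OF X] by eventually_elim (auto simp: indicator_def)
  have h': "?h \<in> borel_measurable lebesgue" by (rule borel_measurable_AE[OF g' AE'])
  have "integral\<^sup>L lebesgue ?h = integral\<^sup>L lebesgue ?g"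
  proof (rule integral_cong_AE[OF h' g'])
    show "AE x in lebesgue. ?h x = ?g x" using AE' by eventually_elim (rule sym)
  qed
  then show ?thesis by (simp add: integral_restrict_space[OF X])
qed

context menu
begin

lemma best_unique: "best v m x \<Longrightarrow> best v n x \<Longrightarrow> m = n"
  unfolding best_def by (metis less_asym)

lemma open_best: "open {x. best v m x}"
proof -
  have "open (\<Inter>n\<in>{..N} - {m}. {x. val v n x < val v m x})"
    unfolding val_def b_def by (intro open_INT) (auto intro!: open_Collect_less continuous_intros)
  moreover have "{x. best v m x} = (if m \<le> N then \<Inter>n\<in>{..N} - {m}. {x. val v n x < val v m x} else {})"
    by (auto simp: best_def)
  ultimately show ?thesis by simp
qed

definition utility :: "(nat \<Rightarrow> real) \<Rightarrow> real \<times> real \<Rightarrow> real" where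
  "utility v x = Max ((\<lambda>m. val v m x) ` {..N})"

lemma val_le_utility: "m \<le> N \<Longrightarrow> val v m x \<le> utility v x"
  unfolding utility_def by (rule Max_ge) auto

lemma utility_attained: "\<exists>m\<le>N. utility v x = val v m x"
proof -
  have "utility v x \<in> (\<lambda>m. val v m x) ` {..N}" unfolding utility_def by (rule Max_in) auto
  then show ?thesis by auto
qed

text \<open>Ties between two goods occur on a line, since different goods have different \<open>z\<close>.\<close>

lemma AE_best: "AE x in lborel. \<exists>m. best v m x"
proof -
  have tie: "AE x in lborel. val v m x \<noteq> val v n x" if "m < n" "n \<le> N" for m n
  proof -
    have "z F (y m) - z F (y n) \<noteq> 0" using y_mono[OF that] by (auto simp: z_def zero_prod_def)
    then have "negligible {x. (z F (y m) - z F (y n)) \<bullet> x = v m - v n}" by (intro negligible_hyperplane) simp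
    then have "AE x in lebesgue. x \<notin> {x. (z F (y m) - z F (y n)) \<bullet> x = v m - v n}"
      by (intro AE_not_in) (simp add: negligible_iff_null_sets)
    then have "AE x in lborel. x \<notin> {x. (z F (y m) - z F (y n)) \<bullet> x = v m - v n}"
      by (simp only: AE_completion_iff)
    then show ?thesis
      by eventually_elim (auto simp: val_def b_def inner_commute inner_diff_left inner_diff_right)
  qed
  have "AE x in lborel. \<forall>m\<in>{..N}. \<forall>n\<in>{..N}. m < n \<longrightarrow> val v m x \<noteq> val v n x"
    using tie by (intro AE_finite_allI) (auto simp: AE_impI)
  then show ?thesis
  proof eventually_elim
    case (elim x)
    obtain m where m: "m \<le> N" "utility v x = val v m x" using utility_attained by blast
    have "val v n x < val v m x" if "n \<le> N" "n \<noteq> m" for n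
    proof -
      have "val v n x \<le> val v m x" using val_le_utility[OF that(1), of v x] m(2) by simp
      moreover have "val v n x \<noteq> val v m x" using elim that m(1) by (metis atMost_iff linorder_neqE_nat)
      ultimately show ?thesis by simp
    qed
    then show ?case using m(1) by (auto simp: best_def)
  qed
qed

lemma utility_best: 
  assumes "best v m x" 
  shows "utility v x = val v m x"
proof (rule antisym)
  obtain n where "n \<le> N" "utility v x = val v n x" using utility_attained by blast
  then show "utility v x \<le> val v m x" using assms by (cases "n = m") (auto simp: best_def)
  show "val v m x \<le> utility v x" using assms by (intro val_le_utility) (simp add: best_def)
qed

lemma y_inj: "inj_on y {..N}"
  using y_mono by (intro linorder_inj_onI) (auto simp: less_imp_neq)

lemma utility_in_utilities:
  assumes "\<And>x. x \<in> X \<Longrightarrow> u x = utility v x"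
  shows "u \<in> utilities F y N"
proof -
  have "(\<lambda>t. b F x t - v (the_inv_into {..N} y t)) ` goods y N = (\<lambda>m. val v m x) ` {..N}" for x
    unfolding goods_def image_image by (intro image_cong) (auto simp: val_def the_inv_into_f_f[OF y_inj])
  then show ?thesis using assms
    unfolding utilities_def utility_def by (auto intro!: exI[of _ "\<lambda>t. v (the_inv_into {..N} y t)"])
qed

text \<open>Near a buyer with a unique best good \<open>m\<close> the utility is the affine function \<open>val v m\<close>, and \<open>z\<close> is
  injective.\<close>

lemma chosen_good_best:
  assumes u: "\<And>x. x \<in> X \<Longrightarrow> u x = utility v x" and x: "x \<in> X" and m: "best v m x"
  shows "chosen_good F y N u x = y m"
proof -
  have "((\<lambda>x. val v m x) has_derivative (\<lambda>h. h \<bullet> z F (y m))) (at x)"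
    unfolding val_def b_def by (auto intro!: derivative_eq_intros)
  then have D: "(u has_derivative (\<lambda>h. h \<bullet> z F (y m))) (at x)"
  proof (rule has_derivative_transform_within_open)
    show "open (X \<inter> {x. best v m x})" using open_X open_best by (rule open_Int)
    show "x \<in> X \<inter> {x. best v m x}" using x m by simp
    show "val v m x' = u x'" if "x' \<in> X \<inter> {x. best v m x}" for x'
      using u[of x'] utility_best[of v m x'] that by simp
  qed
  show ?thesis
    unfolding chosen_good_def
  proof (rule the_equality)
    show "y m \<in> goods y N \<and> GDERIV u x :> z F (y m)"
      using m D by (auto simp: goods_def best_def gderiv_def)
    fix t assume "t \<in> goods y N \<and> GDERIV u x :> z F t"
    then have "(u has_derivative (\<lambda>h. h \<bullet> z F t)) (at x)" by (simp add: gderiv_def)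
    from has_derivative_unique[OF this D] have "(1, 0) \<bullet> z F t = (1, 0) \<bullet> z F (y m)" by meson
    then show "t = y m" by (simp add: z_def)
  qed
qed

definition margin :: "(real \<times> real \<Rightarrow> real) \<Rightarrow> (nat \<Rightarrow> real) \<Rightarrow> real \<times> real \<Rightarrow> real" where
  "margin c v x = (\<Sum>m\<le>N. if best v m x then v m - c (z F (y m)) else 0)"

lemma margin_best:
  assumes "best v m x"
  shows "margin c v x = v m - c (z F (y m))"
proof -
  have "best v n x \<longleftrightarrow> n = m" for n using best_unique assms by blast
  then have "margin c v x = (\<Sum>n\<le>N. if n = m then v n - c (z F (y n)) else 0)"
    by (simp only: margin_def)
  then show ?thesis using assms by (simp add: best_def)
qed

lemma margin_measurable: "margin c v \<in> borel_measurable borel"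
proof -
  have "{x. best v m x} \<in> sets borel" for m using open_best by (rule borel_open)
  then have [measurable]: "Measurable.pred borel (best v m)" for m by (simp add: pred_def)
  show ?thesis unfolding margin_def[abs_def] by measurable
qed

lemma margin_bound: "\<bar>margin c v x\<bar> \<le> (\<Sum>m\<le>N. \<bar>v m - c (z F (y m))\<bar>)"
  unfolding margin_def by (rule order_trans[OF sum_abs]) (auto intro!: sum_mono)

end

lemma (in bounded_density) integrable_bounded_times_f:
  fixes g :: "real \<times> real \<Rightarrow> real"
  assumes g: "g \<in> borel_measurable borel" and B: "\<And>x. \<bar>g x\<bar> \<le> B"
  shows "integrable (lebesgue_on X) (\<lambda>x. g x * f x)"
proof (rule Bochner_Integration.integrable_bound)
  have "X \<subseteq> cbox (0, 0) (1, 1)" by (auto simp: X_def cbox_Pair_eq)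
  then have "bounded X" using bounded_cbox bounded_subset by blast
  then have "emeasure lebesgue X < \<infinity>"
    using X_lebesgue by (metis bounded_set_imp_lmeasurable fmeasurableD2 less_top infinity_ennreal_def)
  then show "integrable (lebesgue_on X) (\<lambda>x. B * K)"
    using X_lebesgue by (intro finite_measure.integrable_const finite_measureI) (simp add: emeasure_restrict_space)
  have "f \<in> borel_measurable (lebesgue_on X)"
    using cont X_lebesgue by (rule continuous_imp_measurable_on_sets_lebesgue)
  moreover have "g \<in> borel_measurable (lebesgue_on X)"
    using g by (intro measurable_restrict_space1) (simp add: measurable_completion)
  ultimately show "(\<lambda>x. g x * f x) \<in> borel_measurable (lebesgue_on X)" by simp
  have "norm (g x * f x) \<le> norm (B * K)" if "x \<in> X" for x
  proof -
    have "\<bar>g x * f x\<bar> \<le> B * K"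
      unfolding abs_mult using B[of x] f_ge[OF that] f_le[OF that] \<alpha>_pos by (intro mult_mono) auto
    then show ?thesis by simp
  qed
  then show "AE x in lebesgue_on X. norm (g x * f x) \<le> norm (B * K)"
    by (intro AE_I2) simp
qed

locale market = menu F y N + bounded_density f \<alpha> K L1 L2
  for F y N f \<alpha> K L1 L2
begin

lemma profit_eq_margin:
  assumes u: "\<And>x. x \<in> X \<Longrightarrow> u x = utility v x"
  shows "profit F c f y N u = (LINT x | lebesgue_on X. margin c v x * f x)"
  unfolding profit_def
proof (rule integral_lebesgue_on_X_cong_AE)
  show "(\<lambda>x. margin c v x * f x) \<in> borel_measurable (lebesgue_on X)"
    using integrable_bounded_times_f[OF margin_measurable margin_bound] by (rule borel_measurable_integrable)
  show "AE x in lebesgue_on X. (b F x (chosen_good F y N u x) - u x - c (z F (chosen_good F y N u x))) * f x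
      = margin c v x * f x"
    unfolding AE_lebesgue_on_X using AE_best[of v]
  proof eventually_elim
    case (elim x)
    then obtain m where m: "best v m x" by blast
    show ?case
    proof
      assume x: "x \<in> X"
      have "b F x (y m) - u x = v m" using u[OF x] utility_best[OF m] by (simp add: val_def)
      moreover have "chosen_good F y N u x = y m" by (rule chosen_good_best[where v = v]) (use u x m in auto)
      ultimately show "(b F x (chosen_good F y N u x) - u x - c (z F (chosen_good F y N u x))) * f x
          = margin c v x * f x"
        by (simp add: margin_best[OF m])
    qed
  qed
qed

end

section \<open>Solutions have no crossing\<close>

lemma continuous_on_Max_image:
  fixes g :: "'i \<Rightarrow> 'a::topological_space \<Rightarrow> real"
  assumes "finite A" "A \<noteq> {}" "\<And>i. i \<in> A \<Longrightarrow> continuous_on U (g i)"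
  shows "continuous_on U (\<lambda>x. Max ((\<lambda>i. g i x) ` A))"
  using assms
proof (induction rule: finite_ne_induct)
  case (insert i A)
  then have "continuous_on U (\<lambda>x. max (g i x) (Max ((\<lambda>i. g i x) ` A)))"
    by (intro continuous_on_max) auto
  then show ?case using insert.hyps by simp
qed simp

context menu
begin

text \<open>The prices recovered from \<open>u\<close> are at most those in any representation of \<open>u\<close>, and they still
  represent \<open>u\<close>.\<close>

lemma utility_price:
  assumes "u \<in> utilities F y N" and "x \<in> X"
  shows "u x = utility (price F y u) x"
proof -
  obtain w where w: "\<And>x. x \<in> X \<Longrightarrow> u x = Max ((\<lambda>t. b F x t - w t) ` goods y N)"
    using assms(1) unfolding utilities_def by blast
  have u: "u x = utility (\<lambda>m. w (y m)) x" if "x \<in> X" for x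
    using w[OF that] by (simp add: utility_def val_def goods_def image_image)
  have le: "b F x (y m) - u x \<le> w (y m)" if "m \<le> N" "x \<in> X" for m x
    using val_le_utility[OF that(1), of "\<lambda>m. w (y m)" x] u[OF that(2)] by (simp add: val_def)
  have price: "price F y u m \<le> w (y m)" if "m \<le> N" for m
    unfolding price_def using le[OF that] assms(2) by (intro cSUP_least) auto
  have price_ge: "b F x (y m) - u x \<le> price F y u m" if "m \<le> N" for m
    unfolding price_def using le[OF that] assms(2) by (intro cSUP_upper) (auto intro!: bdd_aboveI2)
  show ?thesis
  proof (rule antisym)
    obtain m where m: "m \<le> N" "utility (\<lambda>m. w (y m)) x = val (\<lambda>m. w (y m)) m x"
      using utility_attained by blast
    then have "u x \<le> val (price F y u) m x"
      using u[OF assms(2)] price[OF m(1)] by (simp add: val_def)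
    also have "\<dots> \<le> utility (price F y u) x" by (rule val_le_utility[OF m(1)])
    finally show "u x \<le> utility (price F y u) x" .
    obtain n where "n \<le> N" "utility (price F y u) x = val (price F y u) n x"
      using utility_attained by blast
    then show "utility (price F y u) x \<le> u x" using price_ge[of n] by (simp add: val_def)
  qed
qed

text \<open>The supremum that defines the price is attained on the closed square, by compactness.\<close>

lemma price_touches:
  assumes u: "u \<in> utilities F y N" and m: "m \<le> N"
  shows "\<exists>s\<in>{0..1}. \<exists>t\<in>{0..1}. \<forall>n\<le>N. val (price F y u) n (s, t) \<le> val (price F y u) m (s, t)"
proof -
  let ?v = "price F y u"
  let ?g = "\<lambda>x. b F x (y m) - utility ?v x"
  have "continuous_on ({0..1} \<times> {0..1}) ?g"
    unfolding utility_def val_def b_def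
    by (intro continuous_intros continuous_on_Max_image) auto
  moreover have "compact ({0..1::real} \<times> {0..1::real})" by (intro compact_Times) auto
  ultimately obtain x where x: "x \<in> {0..1} \<times> {0..1}" "\<And>x'. x' \<in> {0..1} \<times> {0..1} \<Longrightarrow> ?g x' \<le> ?g x"
    using continuous_attains_sup[of "{0..1::real} \<times> {0..1::real}" ?g] by auto
  have "(1/2, 1/2) \<in> X" by simp
  then have ne: "X \<noteq> {}" by blast
  have "?v m \<le> ?g x"
    unfolding price_def
  proof (rule cSUP_least[OF ne])
    fix x' assume x': "x' \<in> X"
    then have "?g x' \<le> ?g x" by (intro x(2)) (auto simp: X_def)
    then show "b F x' (y m) - u x' \<le> b F x (y m) - utility (\<lambda>r. SUP x\<in>X. b F x (y r) - u x) x"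
      using utility_price[OF u x'] by (simp add: price_def[abs_def])
  qed
  then have "utility ?v x \<le> val ?v m x" by (simp add: val_def)
  then have "val ?v n x \<le> val ?v m x" if "n \<le> N" for n using val_le_utility[OF that, of ?v x] by simp
  then show ?thesis using x(1) by (intro bexI[of _ "fst x"] bexI[of _ "snd x"]) auto
qed

lemma discretely_nested_if_no_crossing:
  assumes no: "\<And>i. \<not> crossing (price F y u) i"
  shows "discretely_nested F y N u"
  unfolding discretely_nested_def
proof (intro allI impI subsetI)
  let ?v = "price F y u"
  fix i j x assume ij: "i < j \<and> j < N" and x: "x \<in> X_le F y i (?v (Suc i) - ?v i)"
  have X: "x \<in> X" using x by (simp add: X_le_def)
  have "gap i * (fst x - threshold ?v i (snd x)) \<le> 0"
    using x val_Suc[of i ?v x] ij by (simp add: X_le_def val_def)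
  then have i: "fst x \<le> threshold ?v i (snd x)" using gap_pos[of i] ij by (auto simp: mult_le_0_iff)
  have step: "fst x < threshold ?v (Suc l) (snd x)" if "fst x \<le> threshold ?v l (snd x)" "Suc l < N" for l
    using no[of "Suc l"] that X by (force simp: crossing_def not_le)
  have "i < j \<Longrightarrow> j < N \<Longrightarrow> fst x < threshold ?v j (snd x)"
  proof (induction j)
    case (Suc j)
    then show ?case using step[of j] i by (cases "i = j") (auto intro: less_imp_le)
  qed simp
  then have "fst x < threshold ?v j (snd x)" using ij by simp
  then have "gap j * (fst x - threshold ?v j (snd x)) < 0" using gap_pos[of j] ij by (intro mult_pos_neg) auto
  then show "x \<in> X_less F y j (?v (Suc j) - ?v j)"
    using X val_Suc[of j ?v x] ij by (simp add: X_less_def val_def)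
qed

end

context market
begin

lemma integral_block_profit:
  assumes "vertex F y N v p r a \<tau> \<epsilon>"
  shows "integrable (lebesgue_on X) (\<lambda>x. vertex.block_profit F y v p r a \<tau> k e x * f x)"
    and "(LINT x | lebesgue_on X. vertex.block_profit F y v p r a \<tau> k e x * f x)
      = (\<Sum>q=p..r. gap q * (level v q + e * (S F y q - chord p r) - k q)
          * cut_mass a \<tau> (chord p r) (S F y q - chord p r) e)"
proof -
  interpret vertex F y N v p r a \<tau> \<epsilon> by fact
  have eq: "block_profit k e x * f x = (\<Sum>q=p..r. gap q * (level v q + e * (S F y q - S0) - k q)
      * (if cut_at q e (snd x) < fst x then f x else 0))" for x
    unfolding block_profit_def sum_distrib_right by (intro sum.cong) auto
  note int = mass_eq_integral_tail[OF cut_measurable]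
  show "integrable (lebesgue_on X) (\<lambda>x. block_profit k e x * f x)"
    unfolding eq by (intro Bochner_Integration.integrable_sum integrable_mult_right int)
  show "(LINT x | lebesgue_on X. block_profit k e x * f x)
      = (\<Sum>q=p..r. gap q * (level v q + e * (S F y q - S0) - k q) * cut_mass a \<tau> S0 (S F y q - S0) e)"
    unfolding eq cut_mass_def int(2)[symmetric]
    by (subst Bochner_Integration.integral_sum) (auto intro!: integrable_mult_right int(1) sum.cong)
qed

lemma profit_change:
  assumes "vertex F y N v p r a \<tau> \<epsilon>" 
    and k: "\<And>q. q \<in> {p..r} \<Longrightarrow> gap q * k q = c (z F (y (Suc q))) - c (z F (y q))"
  shows "(LINT x | lebesgue_on X. margin c (vertex.moved F y v p r \<epsilon>) x * f x)
      - (LINT x | lebesgue_on X. margin c v x * f x)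
    = (\<Sum>q=p..r. gap q * (level v q + \<epsilon> * (S F y q - chord p r) - k q)
          * cut_mass a \<tau> (chord p r) (S F y q - chord p r) \<epsilon>)
      - (\<Sum>q=p..r. gap q * (level v q - k q) * cut_mass a \<tau> (chord p r) (S F y q - chord p r) 0)"
proof -
  interpret vertex F y N v p r a \<tau> \<epsilon> by fact
  have moved0: "moved 0 = v" by (simp add: moved_def fun_eq_iff)
  note int_m = integrable_bounded_times_f[OF margin_measurable margin_bound]
  note int_b = integral_block_profit[OF assms(1)]
  have "(LINT x | lebesgue_on X. margin c (moved \<epsilon>) x * f x - block_profit k \<epsilon> x * f x)
      = (LINT x | lebesgue_on X. margin c v x * f x - block_profit k 0 x * f x)"
  proof (rule integral_cong_AE)
    show "AE x in lebesgue_on X. margin c (moved \<epsilon>) x * f x - block_profit k \<epsilon> x * f x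
        = margin c v x * f x - block_profit k 0 x * f x"
      unfolding AE_lebesgue_on_X using AE_best[of "moved \<epsilon>"] AE_best[of "moved 0"]
    proof eventually_elim
      case (elim x)
      then obtain M1 M0 where M: "best (moved \<epsilon>) M1 x" "best (moved 0) M0 x" by blast
      have "margin c (moved \<epsilon>) x - block_profit k \<epsilon> x = margin c v x - block_profit k 0 x"
        using profit_change_pointwise[OF M(2,1) k] margin_best[OF M(1)] margin_best[OF M(2)] moved0 by simp
      then show ?case by (metis left_diff_distrib)
    qed
  qed (intro borel_measurable_integrable Bochner_Integration.integrable_diff int_m int_b(1))+
  then show ?thesis
    by (simp add: int_m int_b)
qed

text \<open>A crossing yields a vertex, and moving it up a little is feasible, since prices only decrease,
  and strictly profitable.\<close>

lemma solution_has_no_crossing: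
  assumes sol: "monopolist_solution F c f y N u"
    and cost_nonneg: "\<And>q. q < N \<Longrightarrow> 0 \<le> C F c y q"
    and unit_cost: "\<And>q. Suc q < N \<Longrightarrow> C F c y q / S F y q < C F c y (Suc q) / S F y (Suc q)"
    and bottom: "\<And>q. Suc q < N \<Longrightarrow> (S F y (Suc q) - S F y q) * (3 / 2 * K + L1 / 2 * (1 + S F y (Suc q) + C F c y (Suc q)))
      < \<alpha> * (C F c y (Suc q) - C F c y q)"
    and side: "\<And>q. Suc q < N \<Longrightarrow> S F y (Suc q) / 2 * (1 / S F y q - 1 / S F y (Suc q))
        * (K * (2 + S F y (Suc q) / S F y q) + L2 * (1 + 2 / S F y q + C F c y (Suc q) / S F y (Suc q)))
      < \<alpha> * ((1 / S F y q - 1 / S F y (Suc q)) + (C F c y (Suc q) / S F y (Suc q) - C F c y q / S F y q))"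
  shows "\<not> crossing (price F y u) i"
proof
  let ?v = "price F y u"
  assume cross: "crossing ?v i"
  have feas: "u \<in> utilities F y N" "\<And>x. x \<in> X \<Longrightarrow> b F x (y 0) \<le> u x"
    and opt: "\<And>w. feasible F y N w \<Longrightarrow> profit F c f y N w \<le> profit F c f y N u"
    using sol by (auto simp: monopolist_solution_def feasible_def)
  have u: "u x = utility ?v x" if "x \<in> X" for x using utility_price[OF feas(1) that] .
  have touch: "\<exists>s\<in>{0..1}. \<exists>t\<in>{0..1}. val ?v (i - 1) (s, t) \<le> val ?v i (s, t) \<and> val ?v (Suc i) (s, t) \<le> val ?v i (s, t)"
    if "1 \<le> i" "i < N" for i
    using price_touches[OF feas(1), of i] that by (meson Suc_leI diff_le_self le_trans less_imp_le)
  obtain p r a \<tau> where pr: "p < r" "r < N" and pt: "0 < a" "a \<le> 1" "0 \<le> \<tau>" "\<tau> < 1"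
    and through: "\<And>q. q \<in> {p..r} \<Longrightarrow> threshold ?v q \<tau> = a"
    and left: "\<And>l. l < p \<Longrightarrow> threshold ?v l \<tau> < a" and right: "\<And>l. r < l \<Longrightarrow> l < N \<Longrightarrow> a < threshold ?v l \<tau>"
    using lowest_crossing[OF cross touch] by metis
  have small: "\<forall>\<^sub>F e in at_right (0::real). e * s < d" if "0 < d" for s d :: real
  proof -
    have "((\<lambda>e. e * s) \<longlongrightarrow> 0) (at_right 0)" by (rule tendsto_eq_intros | simp)+
    then show ?thesis using that by (rule order_tendstoD(2))
  qed
  have ev: "\<forall>\<^sub>F e in at_right (0::real). 0 < e \<and> e * chord p r < a \<and> e * 1 < 1 - \<tau>
      \<and> (\<forall>l\<in>{..<p}. e * chord p r < a - threshold ?v l \<tau>)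
      \<and> (\<forall>l\<in>{r<..<N}. e * S F y l < threshold ?v l \<tau> - a)"
    using pt left right
    by (intro eventually_conj eventually_ball_finite ballI small eventually_at_right_less) auto
  obtain \<epsilon> where "0 < \<epsilon> \<and> \<epsilon> * chord p r < a \<and> \<epsilon> * 1 < 1 - \<tau>
      \<and> (\<forall>l\<in>{..<p}. \<epsilon> * chord p r < a - threshold ?v l \<tau>)
      \<and> (\<forall>l\<in>{r<..<N}. \<epsilon> * S F y l < threshold ?v l \<tau> - a)"
    using eventually_happens'[OF trivial_limit_at_right_real ev] by blast
  then have \<epsilon>: "0 < \<epsilon>" "\<epsilon> * chord p r < a" "\<epsilon> < 1 - \<tau>"
    "\<And>l. l < p \<Longrightarrow> \<epsilon> * chord p r < a - threshold ?v l \<tau>"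
    "\<And>l. r < l \<Longrightarrow> l < N \<Longrightarrow> \<epsilon> * S F y l < threshold ?v l \<tau> - a"
    by auto
  have vertex: "vertex F y N ?v p r a \<tau> \<epsilon>"
    by unfold_locales (use pr through \<epsilon> in auto)
  interpret vertex F y N ?v p r a \<tau> \<epsilon> by (rule vertex)
  have k: "gap q * C F c y q = c (z F (y (Suc q))) - c (z F (y q))" if "q < N" for q
    using y_Suc[OF that] by (simp add: gap_def C_def)
  have gain: "(\<Sum>q=p..r. gap q * (level ?v q - C F c y q) * cut_mass a \<tau> S0 (S F y q - S0) 0)
    < (\<Sum>q=p..r. gap q * (level ?v q + \<epsilon> * (S F y q - S0) - C F c y q) * cut_mass a \<tau> S0 (S F y q - S0) \<epsilon>)"
  proof (rule vertex_profit_increases[OF pr(1) _ sum_tilt chord_pos])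
    fix q assume q: "q \<in> {p..r}"
    show "0 < gap q" using gap_pos q pr by simp
    show "0 < S F y q \<and> 0 \<le> C F c y q" using slope_pos cost_nonneg q pr by simp
    show "level ?v q = a + S F y q * \<tau>" by (rule level_block[OF q])
  next
    fix q assume q: "p < q" "q \<le> r"
    then obtain n where n: "q = Suc n" "Suc n < N" using pr by (cases q) auto
    show "S F y (q - 1) < S F y q" using slope_Suc[OF n(2)] n(1) by simp
    show "C F c y (q - 1) / S F y (q - 1) < C F c y q / S F y q" using unit_cost[OF n(2)] n(1) by simp
    show "(S F y q - S F y (q - 1)) * (3 / 2 * K + L1 / 2 * (1 + S F y q + C F c y q))
        < \<alpha> * (C F c y q - C F c y (q - 1))" using bottom[OF n(2)] n(1) by simp
    show "S F y q / 2 * (1 / S F y (q - 1) - 1 / S F y q)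
        * (K * (2 + S F y q / S F y (q - 1)) + L2 * (1 + 2 / S F y (q - 1) + C F c y q / S F y q))
      < \<alpha> * ((1 / S F y (q - 1) - 1 / S F y q) + (C F c y q / S F y q - C F c y (q - 1) / S F y (q - 1)))"
      using side[OF n(2)] n(1) by simp
  qed (use pt \<epsilon> in \<open>auto simp: mult.commute\<close>)
  let ?w = "utility (moved \<epsilon>)"
  have "feasible F y N ?w"
    unfolding feasible_def
  proof (intro conjI ballI)
    show "?w \<in> utilities F y N" by (rule utility_in_utilities) simp
    fix x assume x: "x \<in> X"
    obtain m where m: "m \<le> N" "utility ?v x = val ?v m x" using utility_attained by blast
    have "b F x (y 0) \<le> u x" by (rule feas(2)[OF x])
    also have "\<dots> = val ?v m x" using u[OF x] m(2) by simp
    also have "\<dots> \<le> val (moved \<epsilon>) m x"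
      using shift_nonpos[of m] \<epsilon>(1) by (simp add: val_def moved_def mult_nonneg_nonpos)
    also have "\<dots> \<le> ?w x" by (rule val_le_utility[OF m(1)])
    finally show "b F x (y 0) \<le> ?w x" .
  qed
  then have "profit F c f y N ?w \<le> profit F c f y N u" by (rule opt)
  then have "(LINT x | lebesgue_on X. margin c (moved \<epsilon>) x * f x) \<le> (LINT x | lebesgue_on X. margin c ?v x * f x)"
    using profit_eq_margin[of u ?v c] profit_eq_margin[of ?w "moved \<epsilon>" c] u by simp
  then show False using profit_change[OF vertex, of "C F c y" c] k pr gain by simp
qed

end

section \<open>The theorem\<close>

theorem theorem1:
  fixes ytilde \<alpha> :: real
    and F :: "real \<Rightarrow> real"
    and c f f1 f2 u :: "real \<times> real \<Rightarrow> real"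
    and \<mu> :: "(real \<times> real) measure"
    and y :: "nat \<Rightarrow> real"
    and N :: nat
  assumes "0 < ytilde"
    and "mono_on {0..ytilde} F" and "convex_on {0..ytilde} F" and "F 0 = 0"
    and "y 0 = 0" and "\<And>i. i < N \<Longrightarrow> y i < y (Suc i)" and "y N \<le> ytilde"
    and "mono_on {0..ytilde} (\<lambda>t. c (z F t))" and "convex_on {0..ytilde} (\<lambda>t. c (z F t))"
    and "c 0 = 0"
    and "prob_space \<mu>" and "\<mu> = density (lebesgue_on X) (\<lambda>x. ennreal (f x))"
    and "0 < \<alpha>" and "\<And>x. x \<in> X \<Longrightarrow> \<alpha> \<le> f x" and "in_Linf f"
    and "has_bounded_gradient f f1 f2"
    \<comment> \<open>the first two conjuncts say that the quotients are meaningful\<close>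
    and a: "\<And>k i j. k < i \<Longrightarrow> i < j \<Longrightarrow> j \<le> N \<Longrightarrow>
      F (y j) - F (y i) \<noteq> 0 \<and> F (y i) - F (y k) \<noteq> 0 \<and>
      (c (z F (y j)) - c (z F (y i))) / (F (y j) - F (y i))
      > (c (z F (y i)) - c (z F (y k))) / (F (y i) - F (y k))"
    and b: "\<And>i. 1 \<le> i \<Longrightarrow> i \<le> N - 1 \<Longrightarrow>
      (C F c y i - C F c y (i - 1)) / (S F y i - S F y (i - 1))
      > (3 / 2 * Linf_norm f + Linf_norm f1 / 2 * (1 + S F y i + C F c y i)) / \<alpha>"
    and c: "\<And>i. 1 \<le> i \<Longrightarrow> i \<le> N - 1 \<Longrightarrow>
      S F y i <
        2 * \<alpha> /
          (Linf_norm f * (2 + S F y i / S F y (i - 1)) +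
           Linf_norm f2 * (1 + 2 / S F y (i - 1) + C F c y i / S F y i)) *
        (1 + (C F c y i / S F y i - C F c y (i - 1) / S F y (i - 1)) /
             (1 / S F y (i - 1) - 1 / S F y i))"
    and "monopolist_solution F c f y N u"
  shows "discretely_nested F y N u"
proof -
  show ?thesis
  proof (cases "2 \<le> N")
    case False
    then show ?thesis by (auto simp: discretely_nested_def)
  next
    case N: True
    note F_mono = assms(2) and F_convex = assms(3) and y0 = assms(5) and y_Suc = assms(6) and yN = assms(7)
      and c_mono = assms(8) and \<alpha>_pos = assms(13) and f_ge = assms(14) and f_Linf = assms(15)
      and grad = assms(16) and sol = assms(20)
    have y_le: "y i \<le> y j" if "i \<le> j" "j \<le> N" for i j
      using that
    proof (induction j)
      case (Suc j)
      then show ?case using y_Suc[of j] by (cases "i = Suc j") (auto intro: order_trans less_imp_le)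
    qed simp
    have y_mem: "y i \<in> {0..ytilde}" if "i \<le> N" for i
      using y_le[of 0 i] y_le[of i N] that y0 yN by auto
    have S_nonneg: "0 \<le> S F y i" and C_nonneg: "0 \<le> C F c y i" if "i < N" for i
      using that y_Suc[OF that] monotone_onD[OF F_mono y_mem y_mem, of i "Suc i"]
        monotone_onD[OF c_mono y_mem y_mem, of i "Suc i"]
      by (auto simp: S_def C_def)
    obtain Lip where "Lip-lipschitz_on X f" using grad by (auto simp: has_bounded_gradient_def)
    then have cont: "continuous_on X f" by (rule lipschitz_on_continuous_on)
    have f1: "in_Linf f1" and f2: "in_Linf f2" using grad by (auto simp: has_bounded_gradient_def)
    have density: "bounded_density f \<alpha> (Linf_norm f) (Linf_norm f1) (Linf_norm f2)"
    proof
      fix s s' t assume "(s, t) \<in> X" "(s', t) \<in> X"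
      then show "\<bar>f (s, t) - f (s', t)\<bar> \<le> Linf_norm f1 * \<bar>s - s'\<bar>"
        using has_bounded_gradient_lipschitz(1)[OF grad] by blast
    next
      fix s t t' assume "(s, t) \<in> X" "(s, t') \<in> X"
      then show "\<bar>f (s, t) - f (s, t')\<bar> \<le> Linf_norm f2 * \<bar>t - t'\<bar>"
        using has_bounded_gradient_lipschitz(2)[OF grad] by blast
    qed (use cont \<alpha>_pos f_ge le_Linf_norm[OF f_Linf cont] in_Linf_AE_bound(2)[OF f1] in_Linf_AE_bound(2)[OF f2] in auto)
    interpret bounded_density f \<alpha> "Linf_norm f" "Linf_norm f1" "Linf_norm f2" by (rule density)
    have S_less: "S F y i < S F y (Suc i)" if i: "Suc i < N" for i
    proof -
      have "S F y i \<le> S F y (Suc i)"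
      proof -
        have slope: "(F (y i) - F (y (Suc i))) / (y i - y (Suc i)) \<le> (F (y (Suc i)) - F (y (Suc (Suc i)))) / (y (Suc i) - y (Suc (Suc i)))"
          using convex_on_slope_le[OF F_convex y_mem y_mem, of i "Suc (Suc i)" "y (Suc i)"] y_Suc[of i] y_Suc[of "Suc i"] i
          by force
        moreover have "S F y n = (F (y n) - F (y (Suc n))) / (y n - y (Suc n))" for n
          unfolding S_def by (subst minus_divide_divide[symmetric]) simp
        ultimately show ?thesis by simp
      qed
      \<comment> \<open>equal slopes would make the quotient in \<open>b\<close> zero, while its lower bound is nonnegative\<close>
      moreover have "S F y i \<noteq> S F y (Suc i)"
      proof
        assume eq: "S F y i = S F y (Suc i)"
        have "(3 / 2 * Linf_norm f + Linf_norm f1 / 2 * (1 + S F y (Suc i) + C F c y (Suc i))) / \<alpha> < 0"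
          using b[of "Suc i"] i eq by simp
        moreover have "0 \<le> (3 / 2 * Linf_norm f + Linf_norm f1 / 2 * (1 + S F y (Suc i) + C F c y (Suc i))) / \<alpha>"
          using K_pos L1_nonneg \<alpha>_pos S_nonneg[of "Suc i"] C_nonneg[of "Suc i"] i by auto
        ultimately show False by simp
      qed
      ultimately show ?thesis by simp
    qed
    have S_pos: "0 < S F y i" if "i < N" for i
    proof (cases i)
      case 0
      have "F (y 1) - F (y 0) \<noteq> 0" using a[of 0 1 2] N by simp
      then have "S F y 0 \<noteq> 0" using y_Suc[of 0] N by (simp add: S_def)
      then show ?thesis using S_nonneg[of 0] N 0 by simp
    next
      case (Suc n)
      then show ?thesis using S_less[of n] S_nonneg[of n] that by simp
    qed
    interpret menu F y N by unfold_locales (use y_Suc S_pos S_less in auto)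
    interpret market F y N f \<alpha> "Linf_norm f" "Linf_norm f1" "Linf_norm f2" ..
    have no_crossing: "\<not> crossing (price F y u) i" for i
    proof (rule solution_has_no_crossing[OF sol C_nonneg])
      fix q assume q: "Suc q < N"
      have dS: "0 < S F y (Suc q) - S F y q" and Sq: "0 < S F y q" "0 < S F y (Suc q)"
        using S_less[OF q] S_pos[of q] S_pos[of "Suc q"] q by auto
      have dy: "0 < y (Suc n) - y n" if "n < N" for n using y_Suc[OF that] by simp
      have "C F c y n / S F y n = (c (z F (y (Suc n))) - c (z F (y n))) / (F (y (Suc n)) - F (y n))" if "n < N" for n
        using dy[OF that] by (simp add: C_def S_def)
      then show "C F c y q / S F y q < C F c y (Suc q) / S F y (Suc q)"
        using a[of q "Suc q" "Suc (Suc q)"] q by simp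
      have "(3 / 2 * Linf_norm f + Linf_norm f1 / 2 * (1 + S F y (Suc q) + C F c y (Suc q))) / \<alpha>
          < (C F c y (Suc q) - C F c y q) / (S F y (Suc q) - S F y q)"
        using b[of "Suc q"] q by simp
      then show "(S F y (Suc q) - S F y q) * (3 / 2 * Linf_norm f + Linf_norm f1 / 2 * (1 + S F y (Suc q) + C F c y (Suc q)))
          < \<alpha> * (C F c y (Suc q) - C F c y q)"
        unfolding pos_less_divide_eq[OF dS] times_divide_eq_left pos_divide_less_eq[OF \<alpha>_pos]
        by (simp only: mult.commute)
      define den where "den = Linf_norm f * (2 + S F y (Suc q) / S F y q) +
          Linf_norm f2 * (1 + 2 / S F y q + C F c y (Suc q) / S F y (Suc q))"
      define \<delta> where "\<delta> = 1 / S F y q - 1 / S F y (Suc q)"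
      define \<Delta> where "\<Delta> = C F c y (Suc q) / S F y (Suc q) - C F c y q / S F y q"
      have "0 < Linf_norm f * (2 + S F y (Suc q) / S F y q)" using K_pos Sq by (intro mult_pos_pos add_pos_pos) auto
      moreover have "0 \<le> Linf_norm f2 * (1 + 2 / S F y q + C F c y (Suc q) / S F y (Suc q))"
        using L2_nonneg Sq C_nonneg[OF q] by (intro mult_nonneg_nonneg add_nonneg_nonneg) auto
      ultimately have den: "0 < den" by (simp add: den_def)
      have \<delta>: "0 < \<delta>" using Sq dS by (simp add: \<delta>_def frac_less2)
      have "S F y (Suc q) < 2 * \<alpha> / den * (1 + \<Delta> / \<delta>)"
        using c[of "Suc q"] q by (simp add: den_def \<delta>_def \<Delta>_def)
      then have "S F y (Suc q) * (den * \<delta> / 2) < 2 * \<alpha> / den * (1 + \<Delta> / \<delta>) * (den * \<delta> / 2)"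
        using den \<delta> by (intro mult_strict_right_mono) auto
      also have "\<dots> = \<alpha> * (\<delta> + \<Delta>)" using den \<delta> by (simp add: field_simps)
      finally have "S F y (Suc q) / 2 * \<delta> * den < \<alpha> * (\<delta> + \<Delta>)" by (simp add: mult_ac)
      then show "S F y (Suc q) / 2 * (1 / S F y q - 1 / S F y (Suc q))
          * (Linf_norm f * (2 + S F y (Suc q) / S F y q) + Linf_norm f2 * (1 + 2 / S F y q + C F c y (Suc q) / S F y (Suc q)))
        < \<alpha> * ((1 / S F y q - 1 / S F y (Suc q)) + (C F c y (Suc q) / S F y (Suc q) - C F c y q / S F y q))"
        unfolding den_def \<delta>_def \<Delta>_def .
    qed
    then show ?thesis by (rule discretely_nested_if_no_crossing)
  qed
qed

end
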